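(* Fix an integer $k\ge 2$ and let $M,N,L$ be $H_\infty$-double cosets in $S_\infty$ (equivalently, modified coset types). Then the structure coefficient $c_{M,N}^L(n)$ is a polynomial in $n$: there is a polynomial $P$ in one variable such that $c_{M,N}^L(n)=P(n)$ for every positive integer $n$ for which $M(n),N(n),L(n)$ are all non-empty. Moreover, if $\|L\|=\|M\|+\|N\|$, then $c_{M,N}^L(n)$ is independent of $n$ (over all such $n$).
   Context: Fix an integer $k\ge 2$. $\mathbb{N}_+$ is the set of positive integers and $[n]=\{1,\dots,n\}$. $S_\infty$ is the group of permutations of $\mathbb{N}_+$ with finite support; $S_{kn}$ is the group of permutations of $[kn]$, viewed inside $S_\infty$ (fixing everything outside $[kn]$). For $i\in\mathbb{N}_+$ let $\Gamma_i=\{k(i-1)+1,\dots,ki\}$, and write $p(r)=i$ if $r\in\Gamma_i$. $H_\infty$ is the subgroup of those $h\in S_\infty$ such that $p(r)=p(s)$ implies $p(h(r))=p(h(s))$, i.e. those permuting the sets $\Gamma_i$; $H_n=H_\infty\cap S_{kn}\cong S_k\wr S_n$. For an $H_\infty$-double coset $M$ in $S_\infty$ put $M(n)=M\cap S_{kn}$; it is either empty or a single $H_n$-double coset of $S_{kn}$, and every $H_n$-double coset in $S_{kn}$ is $M(n)$ for a unique $M$. If $M(n)\ne\emptyset$, put $S_M(n)=\frac{1}{|H_n|}\sum_{g\in M(n)}g\in\mathbb{C}[S_{kn}]$. These elements form a basis of the Hecke algebra of the pair $(S_{kn},H_n)$, and the structure coefficients $c_{M,N}^L(n)$ are defined (for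 $n$ with $M(n),N(n)\neq\emptyset$) by $S_M(n)\cdot S_N(n)=\sum_{L:\,L(n)\ne\emptyset}c_{M,N}^L(n)\,S_L(n)$. For $g\in S_{kn}$, the graph $G_g$ (loops and multiple edges allowed) has vertices $v_1,\dots,v_n$, and for each $u\in[n]$ and each two-element subset $\{r,s\}\subset\Gamma_u$ it has one edge $e^g_{r,s}$ joining $v_{p(g^{-1}(r))}$ and $v_{p(g^{-1}(s))}$ (a loop if these coincide). The modified coset type of $g$ is the graph obtained from $G_g$ by removing the connected components that consist of a single vertex. The weight of a finite graph is (number of vertices) minus (number of connected components). For an $H_\infty$-double coset $M$, $\|M\|$ denotes the weight of $G_g$ (equivalently, of the modified coset type of $g$) for any $g\in M$ and any $n$ with $g\in S_{kn}$; it does not depend on these choices. *)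

theory Defs
  imports Complex_Main "HOL-Combinatorics.Permutations" "HOL-Computational_Algebra.Polynomial"
begin

text \<open>Permutations are total functions on \<^typ>\<open>nat\<close> fixing \<open>0\<close>; the product of \<open>g\<close> and \<open>h\<close>
  is \<open>g \<circ> h\<close>.\<close>

definition sym_inf :: "(nat \<Rightarrow> nat) set" where
  "sym_inf = {g. g permutes {1..} \<and> finite {r. g r \<noteq> r}}"

definition sym_fin :: "nat \<Rightarrow> (nat \<Rightarrow> nat) set" where
  "sym_fin m = {g. g permutes {1..m}}"

definition block :: "nat \<Rightarrow> nat \<Rightarrow> nat set" where
  "block k i = {k * (i - 1) + 1 .. k * i}"

definition block_index :: "nat \<Rightarrow> nat \<Rightarrow> nat" where
  "block_index k r = (THE i. 1 \<le> i \<and> r \<in> block k i)"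

lemma block_index_formula:
  assumes "1 \<le> k" "1 \<le> r"
  shows "block_index k r = (r - 1) div k + 1"
proof -
  have eq: "i = (r - 1) div k + 1" if "1 \<le> i" "r \<in> block k i" for i
  proof -
    obtain j where j: "i = Suc j" using \<open>1 \<le> i\<close> by (cases i) auto
    have "(r - 1) div k = j"
      using that(2) assms by (intro div_nat_eqI) (auto simp: block_def j algebra_simps)
    then show ?thesis using j by simp
  qed
  define q where "q = (r - 1) div k"
  have "k * q \<le> r - 1"
    unfolding q_def by simp
  moreover have "r - 1 < k * q + k"
    unfolding q_def using assms dividend_less_times_div[of k "r - 1"] by simp
  ultimately have mem: "r \<in> block k ((r - 1) div k + 1)"
    unfolding q_def[symmetric] using assms by (auto simp: block_def)
  show ?thesis
    unfolding block_index_def by (rule the_equality) (use eq mem in auto)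
qed

definition hyp_inf :: "nat \<Rightarrow> (nat \<Rightarrow> nat) set" where
  "hyp_inf k = {h \<in> sym_inf. \<forall>r\<ge>1. \<forall>s\<ge>1.
     block_index k r = block_index k s \<longrightarrow> block_index k (h r) = block_index k (h s)}"

definition hyp_fin :: "nat \<Rightarrow> nat \<Rightarrow> (nat \<Rightarrow> nat) set" where
  "hyp_fin k n = hyp_inf k \<inter> sym_fin (k * n)"

definition double_cosets :: "nat \<Rightarrow> (nat \<Rightarrow> nat) set set" where
  "double_cosets k =
     (\<lambda>g. {h \<circ> g \<circ> h' | h h'. h \<in> hyp_inf k \<and> h' \<in> hyp_inf k}) ` sym_inf"

definition dc_part :: "nat \<Rightarrow> (nat \<Rightarrow> nat) set \<Rightarrow> nat \<Rightarrow> (nat \<Rightarrow> nat) set" where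
  "dc_part k M n = M \<inter> sym_fin (k * n)"

definition double_cosets_at :: "nat \<Rightarrow> nat \<Rightarrow> (nat \<Rightarrow> nat) set set" where
  "double_cosets_at k n = {L \<in> double_cosets k. dc_part k L n \<noteq> {}}"

text \<open>An element of the complex group algebra of a finite permutation group \<open>G\<close> is its
  coefficient function, vanishing outside \<open>G\<close>.\<close>

type_synonym group_alg = "(nat \<Rightarrow> nat) \<Rightarrow> complex"

definition ga_mult :: "(nat \<Rightarrow> nat) set \<Rightarrow> group_alg \<Rightarrow> group_alg \<Rightarrow> group_alg" where
  "ga_mult G a b = (\<lambda>g. \<Sum>(x, y) \<in> {(x, y) \<in> G \<times> G. x \<circ> y = g}. a x * b y)"

definition dc_sum :: "nat \<Rightarrow> (nat \<Rightarrow> nat) set \<Rightarrow> nat \<Rightarrow> group_alg" where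
  "dc_sum k M n = (\<lambda>g. of_bool (g \<in> dc_part k M n) / of_nat (card (hyp_fin k n)))"

text \<open>Requiring the family \<open>c\<close> to vanish on all \<open>L\<close> outside the index set of the expansion
  makes it unique.\<close>

definition is_expansion ::
    "nat \<Rightarrow> (nat \<Rightarrow> nat) set \<Rightarrow> (nat \<Rightarrow> nat) set \<Rightarrow> nat \<Rightarrow> ((nat \<Rightarrow> nat) set \<Rightarrow> complex) \<Rightarrow> bool" where
  "is_expansion k M N n c \<longleftrightarrow>
     (\<forall>L. L \<notin> double_cosets_at k n \<longrightarrow> c L = 0) \<and>
     ga_mult (sym_fin (k * n)) (dc_sum k M n) (dc_sum k N n) =
       (\<lambda>g. \<Sum>L \<in> double_cosets_at k n. c L * dc_sum k L n g)"

definition struct_coeff ::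
    "nat \<Rightarrow> (nat \<Rightarrow> nat) set \<Rightarrow> (nat \<Rightarrow> nat) set \<Rightarrow> (nat \<Rightarrow> nat) set \<Rightarrow> nat \<Rightarrow> complex" where
  "struct_coeff k M N L n = (THE c. is_expansion k M N n c) L"

text \<open>Undirected graphs with loops and multiple edges: \<open>ends\<close> maps an edge to its set of
  endpoints, a singleton for a loop.\<close>

record ('v, 'e) multigraph =
  verts :: "'v set"
  edges :: "'e set"
  ends :: "'e \<Rightarrow> 'v set"

definition adjacency :: "('v, 'e) multigraph \<Rightarrow> ('v \<times> 'v) set" where
  "adjacency G = {(v, w). \<exists>e \<in> edges G. ends G e = {v, w}}"

definition components :: "('v, 'e) multigraph \<Rightarrow> 'v set set" where
  "components G = verts G // {(v, w) \<in> verts G \<times> verts G. (v, w) \<in> (adjacency G)\<^sup>*}"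

definition graph_weight :: "('v, 'e) multigraph \<Rightarrow> int" where
  "graph_weight G = int (card (verts G)) - int (card (components G))"

text \<open>The vertex \<open>v\<^sub>i\<close> is \<open>i\<close>, and the edge \<open>e\<^bsub>r,s\<^esub>\<close> is the two-element set \<open>{r, s}\<close>.\<close>

definition coset_graph :: "nat \<Rightarrow> nat \<Rightarrow> (nat \<Rightarrow> nat) \<Rightarrow> (nat, nat set) multigraph" where
  "coset_graph k n g =
     \<lparr> verts = {1..n},
       edges = {e. \<exists>u \<in> {1..n}. e \<subseteq> block k u \<and> card e = 2},
       ends = (\<lambda>e. (\<lambda>r. block_index k (inv g r)) ` e) \<rparr>"

definition dc_weight :: "nat \<Rightarrow> (nat \<Rightarrow> nat) set \<Rightarrow> int" where
  "dc_weight k M = (THE w. \<forall>n. \<forall>g \<in> dc_part k M n. graph_weight (coset_graph k n g) = w)"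

end

theory Submission
  imports Defs
begin

text \<open>Left cosets \<open>x H\<close> correspond to the partitions \<open>{x ` \<Gamma>\<^sub>i}\<close> into blocks of size \<open>k\<close>. Hence, for
  \<open>g \<in> L(n)\<close>, the coefficient \<open>c(n)\<close> counts the partitions \<open>\<pi>\<close> of \<open>[kn]\<close> that are in relative position
  \<open>M\<close> to the standard partition \<open>\<Gamma>\<close> and from which \<open>g \<Gamma>\<close> is in relative position \<open>N\<close>. The number of
  standard blocks missing from \<open>\<pi>\<close> depends only on \<open>M\<close>. Fix \<open>g \<in> S\<^bsub>km\<^esub>\<close> and sort the \<open>\<pi>\<close> by the set
  \<open>T\<close> of indices beyond \<open>m\<close> of missing blocks: permutations of the blocks beyond \<open>m\<close> commute with
  \<open>g\<close>, so the number of \<open>\<pi>\<close> depends only on \<open>t = card T\<close>, and \<open>c(n)\<close> is a combination of the binomial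
  coefficients \<open>(n - m) choose t\<close> with bounded \<open>t\<close>.

  The components of \<open>G\<^sub>g\<close> are the blocks of the join of \<open>\<Gamma>\<close> and \<open>g \<Gamma>\<close>, so the number of subsets of
  \<open>[kn]\<close> that are unions of blocks of both is \<open>2\<close> to the number of components. Let \<open>F\<^sub>\<pi>\<close> be the
  set of unions of blocks of \<open>\<pi>\<close>, a group under symmetric difference. If the weights add up, then
  \<open>card A * card B \<le> card C * card (A \<inter> B)\<close> with \<open>A = F\<^sub>\<Gamma> \<inter> F\<^sub>\<pi>\<close>, \<open>B = F\<^sub>\<pi> \<inter> F\<^bsub>g\<Gamma>\<^esub>\<close> and
  \<open>C = F\<^sub>\<pi>\<close> forces \<open>F\<^sub>\<Gamma> \<inter> F\<^bsub>g\<Gamma>\<^esub> \<subseteq> F\<^sub>\<pi>\<close>. So every block beyond \<open>m\<close> is a block of \<open>\<pi>\<close>, and only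
  \<open>t = 0\<close> contributes.\<close>

subsection \<open>Finitely supported permutations\<close>

lemma sym_fin_mono: "m \<le> n \<Longrightarrow> sym_fin m \<subseteq> sym_fin n"
  by (auto simp: sym_fin_def intro: permutes_subset)

lemma finite_sym_fin: "finite (sym_fin n)"
  by (simp add: sym_fin_def finite_permutations)

lemma sym_inf_eq: "sym_inf = (\<Union>n. sym_fin n)"
proof (intro equalityI subsetI)
  fix g assume "g \<in> sym_inf"
  then have g: "g permutes {1..}" and "finite {r. g r \<noteq> r}"
    by (auto simp: sym_inf_def)
  then obtain n where n: "\<And>r. g r \<noteq> r \<Longrightarrow> r \<le> n"
    by (metis (mono_tags, lifting) finite_nat_set_iff_bounded_le mem_Collect_eq)
  have "g permutes {1..n}"
    using g by (rule permutes_superset) (use n in auto)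
  then show "g \<in> (\<Union>n. sym_fin n)" by (auto simp: sym_fin_def)
next
  fix g assume "g \<in> (\<Union>n. sym_fin n)"
  then obtain n where g: "g permutes {1..n}" by (auto simp: sym_fin_def)
  have "{r. g r \<noteq> r} \<subseteq> {1..n}" using g by (auto simp: permutes_def)
  then have "finite {r. g r \<noteq> r}" by (rule finite_subset) simp
  moreover have "g permutes {1..}" by (rule permutes_subset[OF g]) auto
  ultimately show "g \<in> sym_inf" by (simp add: sym_inf_def)
qed

lemma sym_fin_in_sym_inf: "g \<in> sym_fin n \<Longrightarrow> g \<in> sym_inf"
  by (auto simp: sym_inf_eq)

text \<open>Having every larger index, and not just one, lets finitely many elements be put into a
  common finite group by taking the maximum of the thresholds.\<close>

lemma sym_inf_mono_obtains:
  assumes "1 \<le> k" "g \<in> sym_inf"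
  obtains n where "\<And>n'. n \<le> n' \<Longrightarrow> g \<in> sym_fin (k * n')"
proof -
  obtain m where m: "g \<in> sym_fin m" using assms by (auto simp: sym_inf_eq)
  show thesis
  proof (rule that[of m])
    fix n' assume "m \<le> n'"
    then have "m \<le> k * n'" using \<open>1 \<le> k\<close> by (metis le_trans mult_le_mono1 nat_mult_1)
    then show "g \<in> sym_fin (k * n')" using m sym_fin_mono by blast
  qed
qed

lemma sym_inf_bij: "g \<in> sym_inf \<Longrightarrow> bij g"
  by (auto simp: sym_inf_def permutes_bij)

lemma sym_inf_inj: "g \<in> sym_inf \<Longrightarrow> inj g"
  by (simp add: sym_inf_bij bij_is_inj)

lemma inj_image: "inj f \<Longrightarrow> inj ((`) f)"
  by (rule injI) (simp add: inj_image_eq_iff)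

lemma inj_image_sym: "g \<in> sym_inf \<Longrightarrow> inj ((`) g)"
  by (rule inj_image[OF sym_inf_inj])

lemma sym_inf_id [simp]: "id \<in> sym_inf"
  by (simp add: sym_inf_def permutes_id)

lemma sym_fin_id [simp]: "id \<in> sym_fin n"
  by (simp add: sym_fin_def permutes_id)

lemma sym_fin_comp: "g \<in> sym_fin n \<Longrightarrow> h \<in> sym_fin n \<Longrightarrow> g \<circ> h \<in> sym_fin n"
  by (simp add: sym_fin_def permutes_compose)

lemma sym_fin_inv: "g \<in> sym_fin n \<Longrightarrow> inv g \<in> sym_fin n"
  by (simp add: sym_fin_def permutes_inv)

lemma sym_inf_comp: assumes "g \<in> sym_inf" "h \<in> sym_inf" shows "g \<circ> h \<in> sym_inf"
proof -
  obtain m n where "g \<in> sym_fin m" "h \<in> sym_fin n"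
    using assms by (auto simp: sym_inf_eq)
  then have "g \<circ> h \<in> sym_fin (max m n)"
    by (meson max.cobounded1 max.cobounded2 subsetD sym_fin_comp sym_fin_mono)
  then show ?thesis by (rule sym_fin_in_sym_inf)
qed

lemma sym_inf_inv: "g \<in> sym_inf \<Longrightarrow> inv g \<in> sym_inf"
  unfolding sym_inf_eq using sym_fin_inv by blast

lemma sym_inf_inv_comp [simp]: "g \<in> sym_inf \<Longrightarrow> inv g \<circ> g = id"
  by (simp add: sym_inf_inj)

lemma sym_inf_comp_inv [simp]: "g \<in> sym_inf \<Longrightarrow> g \<circ> inv g = id"
  using sym_inf_bij[of g] by (metis bij_is_surj surj_iff)

lemma sym_inf_ge_1: "g \<in> sym_inf \<Longrightarrow> 1 \<le> g r \<longleftrightarrow> 1 \<le> r"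
  using permutes_in_image[of g "{1..}" r] by (auto simp: sym_inf_def)

lemma sym_fin_fix: "g \<in> sym_fin n \<Longrightarrow> n < r \<Longrightarrow> g r = r"
  by (auto simp: sym_fin_def permutes_def)

lemma sym_fin_image: "g \<in> sym_fin n \<Longrightarrow> g ` {1..n} = {1..n}"
  by (simp add: sym_fin_def permutes_image)

subsection \<open>Blocks\<close>

lemma finite_block [simp]: "finite (block k i)"
  by (simp add: block_def)

lemma card_block: "1 \<le> i \<Longrightarrow> card (block k i) = k"
  by (cases i) (simp_all add: block_def)

lemma block_ge_1: "r \<in> block k i \<Longrightarrow> 1 \<le> r"
  by (simp add: block_def)

text \<open>For \<open>x \<in> sym_inf\<close>, the partition \<open>x \<Gamma>\<close>; it labels
  the left coset of \<open>x\<close> modulo \<open>hyp_inf k\<close>, see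
  \<open>block_images_eq_iff\<close>.\<close>

definition block_images :: "nat \<Rightarrow> (nat \<Rightarrow> nat) \<Rightarrow> nat set set" where
  "block_images k x = (\<lambda>i. x ` block k i) ` {1..}"

lemma block_images_comp: "block_images k (h \<circ> x) = (`) h ` block_images k x"
  by (simp add: block_images_def image_image image_comp)

context
  fixes k :: nat
  assumes k: "1 \<le> k"
begin

lemma block_index_ge_1: "1 \<le> r \<Longrightarrow> 1 \<le> block_index k r"
  using k by (simp add: block_index_formula)

lemma in_block_iff: "1 \<le> r \<Longrightarrow> 1 \<le> i \<Longrightarrow> r \<in> block k i \<longleftrightarrow> block_index k r = i"
proof -
  assume r: "1 \<le> r" and i: "1 \<le> i"
  obtain j where j: "i = Suc j" using i by (cases i) auto
  obtain q where q: "r = Suc q" using r by (cases r) auto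
  have "q div k = j \<longleftrightarrow> k * j \<le> q \<and> q < k * j + k"
  proof
    assume "q div k = j"
    then show "k * j \<le> q \<and> q < k * j + k"
      using k dividend_less_times_div[of k q] times_div_less_eq_dividend[of k q] by auto
  next
    assume "k * j \<le> q \<and> q < k * j + k"
    then show "q div k = j" by (intro div_nat_eqI) (auto simp: algebra_simps)
  qed
  then show ?thesis using k r by (auto simp: block_index_formula block_def j q)
qed

lemma block_index_eq: "r \<in> block k i \<Longrightarrow> 1 \<le> i \<Longrightarrow> block_index k r = i"
  using in_block_iff block_ge_1 by blast

lemma block_index_mem: "1 \<le> r \<Longrightarrow> r \<in> block k (block_index k r)"
  using in_block_iff block_index_ge_1 by blast

lemma block_nonempty: "1 \<le> i \<Longrightarrow> block k i \<noteq> {}"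
  using card_block[of i k] k by auto

lemma inj_on_block: "inj_on (block k) {1..}"
  by (rule inj_onI) (metis atLeast_iff block_index_eq block_nonempty ex_in_conv)

lemma block_subset_iff: "1 \<le> i \<Longrightarrow> block k i \<subseteq> {1..k * n} \<longleftrightarrow> i \<le> n"
proof
  assume i: "1 \<le> i" and "block k i \<subseteq> {1..k * n}"
  moreover have "k * i \<in> block k i" using i k by (cases i) (auto simp: block_def)
  ultimately have "k * i \<le> k * n" by auto
  then show "i \<le> n" using k by simp
next
  assume "i \<le> n"
  then have "k * i \<le> k * n" by simp
  then show "block k i \<subseteq> {1..k * n}" unfolding block_def by (auto intro: order_trans)
qed

lemma block_index_le_iff: "1 \<le> r \<Longrightarrow> block_index k r \<le> n \<longleftrightarrow> r \<le> k * n"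
proof -
  assume r: "1 \<le> r"
  have "block_index k r \<le> n \<longleftrightarrow> (r - 1) div k < n"
    using r k by (auto simp: block_index_formula)
  also have "\<dots> \<longleftrightarrow> r - 1 < n * k"
    using k by (intro div_less_iff_less_mult) auto
  also have "\<dots> \<longleftrightarrow> r \<le> k * n"
    using r by (auto simp: mult.commute)
  finally show ?thesis .
qed

lemma block_beyond:
  assumes "n < i" "r \<in> block k i" shows "k * n < r"
proof -
  have "block_index k r = i" using assms by (intro block_index_eq) auto
  then show ?thesis
    using block_index_le_iff[OF block_ge_1[OF assms(2)], of n] assms(1) by linarith
qed

lemma block_images_id: "block_images k id = block k ` {1..}"
  by (simp add: block_images_def)

lemma block_images_cover:
  assumes "x \<in> sym_inf" "1 \<le> r" obtains B where "B \<in> block_images k x" "r \<in> B"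
proof -
  define s where "s = inv x r"
  have s: "1 \<le> s" "r = x s"
    using assms sym_inf_ge_1[OF sym_inf_inv] sym_inf_bij[of x]
    by (auto simp: s_def bij_is_surj surj_f_inv_f)
  show thesis
    by (rule that[of "x ` block k (block_index k s)"])
      (use s block_index_mem block_index_ge_1 in \<open>auto simp: block_images_def\<close>)
qed

lemma block_images_disjoint:
  assumes "x \<in> sym_inf" "B \<in> block_images k x" "C \<in> block_images k x" "B \<inter> C \<noteq> {}"
  shows "B = C"
proof -
  obtain i j where ij: "B = x ` block k i" "C = x ` block k j" "1 \<le> i" "1 \<le> j"
    using assms by (auto simp: block_images_def)
  then obtain r s where "r \<in> block k i" "s \<in> block k j" "x r = x s" using assms(4) by auto
  then have "i = j" using sym_inf_inj[OF assms(1)] ij block_index_eq by (metis injD)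
  then show ?thesis using ij by simp
qed

lemma block_images_card:
  assumes "x \<in> sym_inf" "B \<in> block_images k x" shows "card B = k" "finite B"
  using assms sym_inf_inj[OF assms(1)] card_block
  by (auto simp: block_images_def card_image inj_on_subset)

lemma block_images_ge_1:
  assumes "x \<in> sym_inf" "B \<in> block_images k x" "r \<in> B" shows "1 \<le> r"
  using assms sym_inf_ge_1 block_ge_1 by (fastforce simp: block_images_def)

text \<open>Both families partition the positive integers, so a block of \<open>y\<close> shares a
  point with a block of \<open>x\<close>, and disjointness identifies the two.\<close>

lemma block_images_subset_eq:
  assumes "x \<in> sym_inf" "y \<in> sym_inf" "block_images k x \<subseteq> block_images k y"
  shows "block_images k x = block_images k y"
proof (intro equalityI assms(3) subsetI)
  fix C assume C: "C \<in> block_images k y"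
  have "C \<noteq> {}" using block_images_card[OF assms(2) C] k by auto
  then obtain r where r: "r \<in> C" "1 \<le> r" using block_images_ge_1[OF assms(2) C] by blast
  obtain B where B: "B \<in> block_images k x" "r \<in> B" using block_images_cover[OF assms(1) r(2)] .
  then have "B = C" using block_images_disjoint[OF assms(2)] assms(3) C r by blast
  then show "C \<in> block_images k x" using B by simp
qed

text \<open>The defining condition sends a standard block into a single standard block; equal
  cardinality makes this an equality, and \<open>block_images_subset_eq\<close> supplies the
  remaining blocks.\<close>

lemma hyp_inf_iff: "h \<in> hyp_inf k \<longleftrightarrow> h \<in> sym_inf \<and> block_images k h = block_images k id"
proof (intro iffI conjI)
  assume h: "h \<in> hyp_inf k"
  then show hs: "h \<in> sym_inf" by (simp add: hyp_inf_def)
  have "block_images k h \<subseteq> block_images k id"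
  proof
    fix B assume B: "B \<in> block_images k h"
    then obtain i where i: "1 \<le> i" "B = h ` block k i" by (auto simp: block_images_def)
    obtain r where r: "r \<in> block k i" using block_nonempty i by blast
    define j where "j = block_index k (h r)"
    have r1: "1 \<le> h r" using r block_ge_1 sym_inf_ge_1 hs by blast
    then have j1: "1 \<le> j" unfolding j_def by (rule block_index_ge_1)
    have "h s \<in> block k j" if s: "s \<in> block k i" for s
    proof -
      have "block_index k (h s) = j"
        using h r s i block_index_eq block_ge_1 unfolding hyp_inf_def j_def by simp
      then show ?thesis using in_block_iff j1 s block_ge_1 sym_inf_ge_1 hs by blast
    qed
    then have "B \<subseteq> block k j" using i by auto
    then have "B = block k j"
      using block_images_card[OF hs B] card_block[OF j1] by (simp add: card_subset_eq)
    then show "B \<in> block_images k id" using j1 by (simp add: block_images_id)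
  qed
  then show "block_images k h = block_images k id"
    using block_images_subset_eq hs by simp
next
  assume "h \<in> sym_inf \<and> block_images k h = block_images k id"
  then have h: "h \<in> sym_inf" and eq: "block_images k h = block k ` {1..}"
    by (simp_all add: block_images_id)
  show "h \<in> hyp_inf k" unfolding hyp_inf_def
  proof (intro CollectI conjI h allI impI)
    fix r s :: nat assume r: "1 \<le> r" and s: "1 \<le> s" and rs: "block_index k r = block_index k s"
    have "h ` block k (block_index k r) \<in> block k ` {1..}"
      unfolding eq[symmetric] block_images_def using block_index_ge_1[OF r] by (intro imageI) auto
    then obtain j where j: "1 \<le> j" "h ` block k (block_index k r) = block k j" by auto
    then have "h r \<in> block k j" "h s \<in> block k j"
      using block_index_mem r s rs by (metis imageI)+
    then show "block_index k (h r) = block_index k (h s)" using block_index_eq j by simp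
  qed
qed

lemma hyp_inf_sym: "h \<in> hyp_inf k \<Longrightarrow> h \<in> sym_inf"
  by (simp add: hyp_inf_def)

lemma block_images_comp_hyp: "h \<in> hyp_inf k \<Longrightarrow> block_images k (x \<circ> h) = block_images k x"
  using block_images_comp[of k x h] block_images_comp[of k x id] by (simp add: hyp_inf_iff)

lemma hyp_inf_id [simp]: "id \<in> hyp_inf k"
  by (simp add: hyp_inf_iff)

lemma hyp_inf_comp: "g \<in> hyp_inf k \<Longrightarrow> h \<in> hyp_inf k \<Longrightarrow> g \<circ> h \<in> hyp_inf k"
  using block_images_comp_hyp by (simp add: hyp_inf_iff sym_inf_comp)

text \<open>Left translation acts on partitions, and the stabiliser of the standard one is
  \<open>hyp_inf k\<close>; so partitions correspond to left cosets.\<close>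

lemma block_images_eq_iff:
  assumes "x \<in> sym_inf" "y \<in> sym_inf"
  shows "block_images k x = block_images k y \<longleftrightarrow> inv x \<circ> y \<in> hyp_inf k"
proof
  assume "block_images k x = block_images k y"
  then have "block_images k (inv x \<circ> y) = block_images k (inv x \<circ> x)"
    by (simp only: block_images_comp)
  then show "inv x \<circ> y \<in> hyp_inf k" using assms by (simp add: hyp_inf_iff sym_inf_comp sym_inf_inv)
next
  assume "inv x \<circ> y \<in> hyp_inf k"
  then have "block_images k (x \<circ> (inv x \<circ> y)) = block_images k x" by (rule block_images_comp_hyp)
  then show "block_images k x = block_images k y" using assms by (simp add: o_assoc)
qed

lemma hyp_inf_inv: "h \<in> hyp_inf k \<Longrightarrow> inv h \<in> hyp_inf k"
  using block_images_eq_iff[of h id] by (simp add: hyp_inf_iff)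

subsection \<open>Double cosets\<close>

lemma double_coset_sym:
  assumes "M \<in> double_cosets k" "x \<in> M" shows "x \<in> sym_inf"
  using assms hyp_inf_sym by (auto simp: double_cosets_def intro!: sym_inf_comp)

lemma double_coset_mult:
  assumes "M \<in> double_cosets k" "x \<in> M" "h \<in> hyp_inf k" "h' \<in> hyp_inf k"
  shows "h \<circ> x \<circ> h' \<in> M"
proof -
  obtain g where g: "M = {h \<circ> g \<circ> h' | h h'. h \<in> hyp_inf k \<and> h' \<in> hyp_inf k}"
    using assms(1) by (auto simp: double_cosets_def)
  then obtain a b where ab: "x = a \<circ> g \<circ> b" "a \<in> hyp_inf k" "b \<in> hyp_inf k"
    using assms(2) by auto
  have "h \<circ> x \<circ> h' = (h \<circ> a) \<circ> g \<circ> (b \<circ> h')" by (simp add: ab o_assoc)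
  then show ?thesis using ab assms hyp_inf_comp g by blast
qed

lemma double_coset_mult_left:
  assumes "M \<in> double_cosets k" "x \<in> M" "h \<in> hyp_inf k" shows "h \<circ> x \<in> M"
  using double_coset_mult[OF assms hyp_inf_id] by simp

lemma double_coset_mult_right:
  assumes "M \<in> double_cosets k" "x \<in> M" "h \<in> hyp_inf k" shows "x \<circ> h \<in> M"
  using double_coset_mult[OF assms(1,2) hyp_inf_id assms(3)] by simp

lemma double_coset_obtains:
  assumes "M \<in> double_cosets k" "x \<in> M" "x' \<in> M"
  obtains h h' where "h \<in> hyp_inf k" "h' \<in> hyp_inf k" "x' = h \<circ> x \<circ> h'"
proof -
  obtain g where g: "M = {h \<circ> g \<circ> h' | h h'. h \<in> hyp_inf k \<and> h' \<in> hyp_inf k}"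
    using assms(1) by (auto simp: double_cosets_def)
  then obtain a b c d where ab: "x = a \<circ> g \<circ> b" "a \<in> hyp_inf k" "b \<in> hyp_inf k"
    and cd: "x' = c \<circ> g \<circ> d" "c \<in> hyp_inf k" "d \<in> hyp_inf k"
    using assms(2,3) by auto
  have "(c \<circ> inv a) \<circ> x \<circ> (inv b \<circ> d) = c \<circ> (inv a \<circ> a) \<circ> g \<circ> (b \<circ> inv b) \<circ> d"
    by (simp add: ab o_assoc del: sym_inf_inv_comp sym_inf_comp_inv inv_o_cancel)
  also have "\<dots> = x'" using ab cd hyp_inf_sym by simp
  finally show thesis
    using that[of "c \<circ> inv a" "inv b \<circ> d"] ab cd hyp_inf_comp hyp_inf_inv by simp
qed

lemma double_coset_eq:
  assumes "M \<in> double_cosets k" "N \<in> double_cosets k" "x \<in> M" "x \<in> N"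
  shows "M = N"
proof -
  have "y \<in> B" if "A \<in> double_cosets k" "B \<in> double_cosets k" "x \<in> A" "x \<in> B" "y \<in> A" for A B y
    using double_coset_obtains[OF that(1,3,5)] double_coset_mult[OF that(2,4)] by metis
  then show ?thesis using assms by blast
qed

lemma double_coset_exists:
  assumes "g \<in> sym_inf" obtains M where "M \<in> double_cosets k" "g \<in> M"
proof
  show "{h \<circ> g \<circ> h' | h h'. h \<in> hyp_inf k \<and> h' \<in> hyp_inf k} \<in> double_cosets k"
    using assms by (auto simp: double_cosets_def)
  show "g \<in> {h \<circ> g \<circ> h' | h h'. h \<in> hyp_inf k \<and> h' \<in> hyp_inf k}"
    using hyp_inf_id by (intro CollectI exI[of _ id]) simp
qed

text \<open>Distinct double cosets are disjoint, so picking an element from each part embeds the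
  index set into a finite group.\<close>

lemma finite_double_cosets_at: "finite (double_cosets_at k n)"
proof (rule inj_on_finite)
  let ?f = "\<lambda>M. SOME g. g \<in> dc_part k M n"
  have f: "M \<in> double_cosets k" "?f M \<in> M" "?f M \<in> sym_fin (k * n)"
    if "M \<in> double_cosets_at k n" for M
    using that some_in_eq[of "dc_part k M n"] by (auto simp: double_cosets_at_def dc_part_def)
  show "inj_on ?f (double_cosets_at k n)"
  proof (rule inj_onI)
    fix M N assume M: "M \<in> double_cosets_at k n" and N: "N \<in> double_cosets_at k n" and eq: "?f M = ?f N"
    show "M = N" by (rule double_coset_eq[OF f(1)[OF M] f(1)[OF N] f(2)[OF M]]) (subst eq, rule f(2)[OF N])
  qed
  show "?f ` double_cosets_at k n \<subseteq> sym_fin (k * n)" using f(3) by blast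
qed (rule finite_sym_fin)

end

section \<open>Counting subsets by size, binomial polynomials, permutations of index sets\<close>

text \<open>Grouping the subsets by size leaves \<open>a + 1\<close> terms, a number that does not
  grow with \<open>S\<close>; this is the source of polynomiality.\<close>

lemma sum_Pow_card:
  fixes f :: "nat \<Rightarrow> nat"
  assumes "finite S" and f: "\<And>t. a < t \<Longrightarrow> f t = 0"
  shows "(\<Sum>T\<in>Pow S. f (card T)) = (\<Sum>t\<le>a. (card S choose t) * f t)"
proof -
  let ?P = "{T \<in> Pow S. card T \<le> a}"
  have "(\<Sum>T\<in>Pow S. f (card T)) = (\<Sum>T\<in>?P. f (card T))"
    using assms by (intro sum.mono_neutral_right) (auto simp: not_le)
  also have "\<dots> = (\<Sum>t\<le>a. \<Sum>T | T \<in> ?P \<and> card T = t. f (card T))"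
    using \<open>finite S\<close> by (intro sum.group[symmetric]) auto
  also have "\<dots> = (\<Sum>t\<le>a. (card S choose t) * f t)"
  proof (intro sum.cong refl)
    fix t assume "t \<in> {..a}"
    then have "{T. T \<in> ?P \<and> card T = t} = {T. T \<subseteq> S \<and> card T = t}" by auto
    then show "(\<Sum>T | T \<in> ?P \<and> card T = t. f (card T)) = (card S choose t) * f t"
      using n_subsets[OF \<open>finite S\<close>, of t] by simp
  qed
  finally show ?thesis .
qed

text \<open>The witness is the falling factorial in \<open>n - m\<close> divided by
  \<open>fact t\<close>; \<open>m \<le> n\<close> makes truncated subtraction agree with that of the
  field.\<close>

lemma binomial_poly:
  obtains P :: "'a :: field_char_0 poly"
  where "\<And>n. m \<le> n \<Longrightarrow> poly P (of_nat n) = of_nat ((n - m) choose t)"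
proof
  fix n assume "m \<le> n"
  then show "poly (smult (1 / fact t) (\<Prod>i=0..<t. [:- of_nat (m + i), 1:])) (of_nat n) =
      (of_nat ((n - m) choose t) :: 'a)"
    by (simp add: poly_prod binomial_gbinomial gbinomial_prod_rev of_nat_diff algebra_simps)
qed

text \<open>Within \<open>T \<union> T'\<close> the complements of \<open>T\<close> and
  \<open>T'\<close> have equal size too, so a bijection of the sets extends to a permutation of the
  union.\<close>

lemma ex_permutes_image:
  assumes "finite T" "finite T'" "card T = card T'"
  obtains \<sigma> where "\<sigma> permutes (T \<union> T')" "\<sigma> ` T = T'"
proof -
  let ?S = "T \<union> T'"
  obtain b where b: "bij_betw b T T'" using assms finite_same_card_bij by blast
  have "card (?S - T) = card (?S - T')" using assms by (simp add: card_Diff_subset)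
  then obtain c where c: "bij_betw c (?S - T) (?S - T')"
    using finite_same_card_bij[of "?S - T" "?S - T'"] assms by blast
  define \<sigma> where "\<sigma> = (\<lambda>i. if i \<in> T then b i else if i \<in> ?S then c i else i)"
  have "bij_betw \<sigma> T T'"
    using b by (subst bij_betw_cong[of _ _ b]) (auto simp: \<sigma>_def)
  moreover have "bij_betw \<sigma> (?S - T) (?S - T')"
    using c by (subst bij_betw_cong[of _ _ c]) (auto simp: \<sigma>_def)
  ultimately have "bij_betw \<sigma> (T \<union> (?S - T)) (T' \<union> (?S - T'))"
    by (rule bij_betw_combine) auto
  moreover have "T \<union> (?S - T) = ?S" "T' \<union> (?S - T') = ?S" by auto
  ultimately have "bij_betw \<sigma> ?S ?S" by simp
  then have "\<sigma> permutes ?S" by (rule bij_imp_permutes) (auto simp: \<sigma>_def)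
  moreover have "\<sigma> ` T = T'" using \<open>bij_betw \<sigma> T T'\<close> by (simp add: bij_betw_def)
  ultimately show thesis by (rule that)
qed

subsection \<open>Block permutations and supports\<close>

lemma permutes_ge_1:
  assumes "\<sigma> permutes {1..n}" shows "1 \<le> \<sigma> i \<longleftrightarrow> 1 \<le> i"
  using permutes_in_image[OF assms, of i] permutes_not_in[OF assms, of i]
  by (cases "i \<in> {1..n}") auto

text \<open>The action of \<open>\<sigma>\<close> on whole blocks: the offset
  \<open>(r - 1) mod k\<close> inside the block is kept, only the block index changes.\<close>

definition block_lift :: "nat \<Rightarrow> (nat \<Rightarrow> nat) \<Rightarrow> nat \<Rightarrow> nat" where
  "block_lift k \<sigma> r =
     (if r = 0 then 0 else k * (\<sigma> (block_index k r) - 1) + (r - 1) mod k + 1)"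

text \<open>The analogue, for a left coset, of the support of a permutation: by
  \<open>block_support_sym_fin\<close> and \<open>hyp_inf_descend\<close> it lies in
  \<open>{1..n}\<close> exactly when the coset meets \<open>sym_fin (k * n)\<close>.\<close>

definition block_support :: "nat \<Rightarrow> nat set set \<Rightarrow> nat set" where
  "block_support k \<pi> = {i. 1 \<le> i \<and> block k i \<notin> \<pi>}"

context
  fixes k :: nat
  assumes k: "1 \<le> k"
begin

lemma block_lift_ge_1: "1 \<le> r \<Longrightarrow> 1 \<le> block_lift k \<sigma> r"
  by (simp add: block_lift_def)

lemma block_index_lift:
  assumes "1 \<le> r" "\<And>i. 1 \<le> i \<Longrightarrow> 1 \<le> \<sigma> i"
  shows "block_index k (block_lift k \<sigma> r) = \<sigma> (block_index k r)"
proof -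
  have "1 \<le> \<sigma> (block_index k r)" using assms block_index_ge_1[OF k] by blast
  moreover have "block_index k (block_lift k \<sigma> r) = (block_lift k \<sigma> r - 1) div k + 1"
    by (rule block_index_formula[OF k block_lift_ge_1[OF assms(1)]])
  ultimately show ?thesis
    using assms k by (simp add: block_lift_def)
qed

lemma block_lift_comp:
  assumes "\<And>i. 1 \<le> i \<Longrightarrow> 1 \<le> \<sigma> i" "\<And>i. 1 \<le> i \<Longrightarrow> 1 \<le> \<tau> i"
  shows "block_lift k \<sigma> \<circ> block_lift k \<tau> = block_lift k (\<sigma> \<circ> \<tau>)"
proof
  fix r
  show "(block_lift k \<sigma> \<circ> block_lift k \<tau>) r = block_lift k (\<sigma> \<circ> \<tau>) r"
  proof (cases "r = 0")
    case False
    then have "block_index k (block_lift k \<tau> r) = \<tau> (block_index k r)"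
      using assms by (intro block_index_lift) auto
    moreover have "(block_lift k \<tau> r - 1) mod k = (r - 1) mod k" "block_lift k \<tau> r \<noteq> 0"
      using False by (simp_all add: block_lift_def)
    ultimately show ?thesis
      using False by (simp add: block_lift_def[of k _ "block_lift k \<tau> r"]) (simp add: block_lift_def)
  qed (simp add: block_lift_def)
qed

lemma block_lift_fix:
  assumes "1 \<le> r" "\<sigma> (block_index k r) = block_index k r" shows "block_lift k \<sigma> r = r"
  using assms k by (simp add: block_lift_def block_index_formula)

lemma block_lift_id: "block_lift k id = id"
proof
  fix r show "block_lift k id r = id r"
    using block_lift_fix[of r id] by (cases "r = 0") (auto simp: block_lift_def)
qed

lemma block_lift_sym_fin:
  assumes "\<sigma> permutes {1..n}" shows "block_lift k \<sigma> \<in> sym_fin (k * n)"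
proof -
  have "bij (block_lift k \<sigma>)"
  proof (rule o_bij)
    show "block_lift k (inv \<sigma>) \<circ> block_lift k \<sigma> = id" "block_lift k \<sigma> \<circ> block_lift k (inv \<sigma>) = id"
      using permutes_ge_1[OF assms] permutes_ge_1[OF permutes_inv[OF assms]] permutes_inv_o[OF assms]
      by (simp_all add: block_lift_comp block_lift_id)
  qed
  moreover have "block_lift k \<sigma> r = r" if r: "r \<notin> {1..k * n}" for r
  proof (cases "r = 0")
    case False
    then have "\<not> block_index k r \<le> n" using r block_index_le_iff[OF k] by auto
    then show ?thesis using False assms by (intro block_lift_fix) (auto simp: permutes_def)
  qed (simp add: block_lift_def)
  ultimately show ?thesis by (auto simp: sym_fin_def bij_iff permutes_def)
qed

lemma block_lift_hyp:
  assumes "\<sigma> permutes {1..n}" shows "block_lift k \<sigma> \<in> hyp_inf k"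
proof -
  have "1 \<le> \<sigma> i" if "1 \<le> i" for i
    using permutes_ge_1[OF assms] that by blast
  then show ?thesis
    using sym_fin_in_sym_inf[OF block_lift_sym_fin[OF assms]]
    by (auto simp: hyp_inf_def block_index_lift)
qed

lemma block_lift_image:
  assumes "\<sigma> permutes {1..n}" "1 \<le> i" shows "block_lift k \<sigma> ` block k i = block k (\<sigma> i)"
proof (rule card_subset_eq)
  have pos: "1 \<le> \<sigma> i" if "1 \<le> i" for i
    using permutes_ge_1[OF assms(1)] that by blast
  show "block_lift k \<sigma> ` block k i \<subseteq> block k (\<sigma> i)"
  proof safe
    fix r assume r: "r \<in> block k i"
    then have r1: "1 \<le> r" by (rule block_ge_1)
    have "block_index k (block_lift k \<sigma> r) = \<sigma> i"
      using block_index_lift[OF r1 pos] block_index_eq[OF k r assms(2)] by simp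
    then show "block_lift k \<sigma> r \<in> block k (\<sigma> i)"
      using in_block_iff[OF k block_lift_ge_1[OF r1] pos[OF assms(2)]] by simp
  qed
  have "inj (block_lift k \<sigma>)"
    using sym_inf_inj hyp_inf_sym[OF k block_lift_hyp[OF assms(1)]] by blast
  then show "card (block_lift k \<sigma> ` block k i) = card (block k (\<sigma> i))"
    using card_block assms(2) pos by (simp add: card_image inj_on_subset)
qed simp

section \<open>Supports of left cosets and descent to smaller symmetric groups\<close>

lemma block_support_sym_fin:
  assumes "x \<in> sym_fin (k * n)" shows "block_support k (block_images k x) \<subseteq> {1..n}"
proof
  fix i assume i: "i \<in> block_support k (block_images k x)"
  show "i \<in> {1..n}"
  proof (rule ccontr)
    assume "i \<notin> {1..n}"
    then have "n < i" "1 \<le> i" using i by (auto simp: block_support_def)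
    then have "x ` block k i = block k i"
      using sym_fin_fix[OF assms] block_beyond[OF k] by (intro trans[OF image_cong image_ident]) auto
    then show False using i \<open>1 \<le> i\<close> by (force simp: block_support_def block_images_def)
  qed
qed

lemma finite_block_support: "x \<in> sym_inf \<Longrightarrow> finite (block_support k (block_images k x))"
  by (metis sym_inf_mono_obtains[OF k] block_support_sym_fin finite_atLeastAtMost finite_subset order_refl)

lemma card_block_support:
  "card (block_support k \<pi>) = card (block_images k id - \<pi>)"
proof -
  have "block k ` block_support k \<pi> = block_images k id - \<pi>"
    by (auto simp: block_support_def block_images_id[OF k])
  moreover have "inj_on (block k) (block_support k \<pi>)"
    by (rule inj_on_subset[OF inj_on_block[OF k]]) (auto simp: block_support_def)
  ultimately show ?thesis by (metis card_image)
qed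

text \<open>A right factor from \<open>hyp_inf k\<close> leaves the partition unchanged; a left
  factor permutes the standard blocks and so carries missing blocks to missing blocks.\<close>

lemma card_block_support_double_coset:
  assumes "M \<in> double_cosets k" "x \<in> M" "x' \<in> M"
  shows "card (block_support k (block_images k x)) = card (block_support k (block_images k x'))"
proof -
  obtain h h' where h: "h \<in> hyp_inf k" "h' \<in> hyp_inf k" "x' = h \<circ> x \<circ> h'"
    using double_coset_obtains[OF k assms] .
  have inj: "inj ((`) h)" by (rule inj_image_sym[OF hyp_inf_sym[OF k h(1)]])
  have "block_images k x' = (`) h ` block_images k x"
    unfolding h(3) block_images_comp_hyp[OF k h(2)] by (rule block_images_comp)
  moreover have "block_images k id = (`) h ` block_images k id"
    using h(1) block_images_comp[of k h id] by (simp add: hyp_inf_iff[OF k])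
  ultimately have "block_images k id - block_images k x' =
      (`) h ` (block_images k id - block_images k x)"
    using image_set_diff[OF inj] by metis
  then show ?thesis
    unfolding card_block_support using inj by (simp add: card_image inj_on_subset)
qed

lemma block_support_lift:
  assumes "\<sigma> permutes {1..n}"
  shows "block_support k (block_images k (block_lift k \<sigma> \<circ> x)) =
    \<sigma> ` block_support k (block_images k x)"
proof -
  let ?h = "block_lift k \<sigma>"
  have inj: "inj ((`) ?h)" by (rule inj_image_sym[OF hyp_inf_sym[OF k block_lift_hyp[OF assms]]])
  have mem: "block k (\<sigma> i) \<in> block_images k (?h \<circ> x) \<longleftrightarrow> block k i \<in> block_images k x"
    if "1 \<le> i" for i
    unfolding block_images_comp block_lift_image[OF assms that, symmetric]
    using inj by (rule inj_image_mem_iff)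
  note pos = permutes_ge_1[OF assms]
  show ?thesis
  proof (intro equalityI subsetI)
    fix j assume j: "j \<in> block_support k (block_images k (?h \<circ> x))"
    obtain i where i: "j = \<sigma> i" using permutes_surj[OF assms] by blast
    show "j \<in> \<sigma> ` block_support k (block_images k x)"
      using j mem[of i] pos[of i] unfolding i by (intro imageI) (auto simp: block_support_def)
  next
    fix j assume "j \<in> \<sigma> ` block_support k (block_images k x)"
    then obtain i where "j = \<sigma> i" "1 \<le> i" "block k i \<notin> block_images k x"
      by (auto simp: block_support_def)
    then show "j \<in> block_support k (block_images k (?h \<circ> x))"
      using mem[of i] pos[of i] by (auto simp: block_support_def)
  qed
qed

text \<open>A standard block occurring in the partition can be made pointwise fixed from the right:
  first exchange two positions so that it is mapped to itself, then undo the rearrangement inside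
  it.\<close>

lemma hyp_inf_descend_step:
  assumes x: "x \<in> sym_fin (k * Suc n)" and "block k (Suc n) \<in> block_images k x"
  obtains h where "h \<in> hyp_inf k" "x \<circ> h \<in> sym_fin (k * n)"
proof -
  let ?B = "block k (Suc n)"
  obtain j where j: "1 \<le> j" "?B = x ` block k j"
    using assms(2) by (auto simp: block_images_def)
  \<comment> \<open>Blocks beyond \<open>Suc n\<close> are fixed by \<open>x\<close>, so none of
    them is mapped onto \<open>?B\<close>.\<close>
  have "j \<le> Suc n"
  proof (rule ccontr)
    assume less: "\<not> j \<le> Suc n"
    then have "x ` block k j = block k j"
      using sym_fin_fix[OF x] block_beyond[OF k, of "Suc n" j]
      by (intro trans[OF image_cong image_ident]) auto
    then have "j = Suc n" using j inj_on_block[OF k] by (auto dest: inj_onD)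
    then show False using less by simp
  qed
  define \<tau> where "\<tau> = transpose j (Suc n)"
  have \<tau>: "\<tau> permutes {1..Suc n}" unfolding \<tau>_def using j \<open>j \<le> Suc n\<close> by (intro permutes_swap_id) auto
  define y where "y = x \<circ> block_lift k \<tau>"
  have y: "y \<in> sym_fin (k * Suc n)"
    unfolding y_def by (rule sym_fin_comp[OF x block_lift_sym_fin[OF \<tau>]])
  have yB: "y ` ?B = ?B"
    using block_lift_image[OF \<tau>, of "Suc n"] j(2) unfolding y_def image_comp[symmetric]
    by (simp add: \<tau>_def)
  have bij: "bij y" using y sym_fin_in_sym_inf sym_inf_bij by blast
  have invB: "inv y ` ?B = ?B" using yB bij by (metis bij_is_inj image_inv_f_f)
  \<comment> \<open>\<open>z\<close> inverts \<open>y\<close> on \<open>?B\<close> only: it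
    preserves every block, hence lies in \<open>hyp_inf k\<close>, and \<open>y \<circ> z\<close>
    fixes \<open>?B\<close> pointwise.\<close>
  define z where "z = (\<lambda>r. if r \<in> ?B then inv y r else r)"
  have "bij_betw (inv y) ?B ?B"
    using invB bij bij_imp_bij_inv bij_is_inj inj_on_subset by (metis bij_betw_def subset_UNIV)
  then have "bij_betw z ?B ?B" by (subst bij_betw_cong[of _ _ "inv y"]) (auto simp: z_def)
  then have "z permutes ?B" by (rule bij_imp_permutes) (auto simp: z_def)
  moreover have "?B \<subseteq> {1..k * Suc n}" by (rule block_subset_iff[OF k, THEN iffD2]) simp_all
  ultimately have z: "z \<in> sym_fin (k * Suc n)"
    unfolding sym_fin_def using permutes_subset by blast
  have zi: "block_index k (z r) = block_index k r" for r
  proof (cases "r \<in> ?B")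
    case True
    then have "z r \<in> ?B" using invB by (auto simp: z_def)
    then show ?thesis using True block_index_eq[OF k] by simp
  qed (simp add: z_def)
  have "z \<in> hyp_inf k"
    using sym_fin_in_sym_inf[OF z] by (auto simp: hyp_inf_def zi)
  then have h: "block_lift k \<tau> \<circ> z \<in> hyp_inf k"
    by (rule hyp_inf_comp[OF k block_lift_hyp[OF \<tau>]])
  have "y \<circ> z permutes {1..k * Suc n}"
    using sym_fin_comp[OF y z] by (simp add: sym_fin_def)
  then have "y \<circ> z permutes {1..k * n}"
  proof (rule permutes_superset)
    fix r assume "r \<in> {1..k * Suc n} - {1..k * n}"
    then have "r \<in> ?B" by (auto simp: block_def)
    then show "(y \<circ> z) r = r" using bij by (simp add: z_def bij_is_surj surj_f_inv_f)
  qed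
  then have "x \<circ> (block_lift k \<tau> \<circ> z) \<in> sym_fin (k * n)"
    by (simp add: y_def sym_fin_def o_assoc)
  with h show thesis by (rule that)
qed

text \<open>As long as the last block lies beyond \<open>n\<close>, it is outside the support and
  can be stripped; the right factors used do not change the partition, so the bound on the support
  persists.\<close>

lemma hyp_inf_descend:
  assumes "x \<in> sym_inf" "block_support k (block_images k x) \<subseteq> {1..n}"
  obtains h where "h \<in> hyp_inf k" "x \<circ> h \<in> sym_fin (k * n)"
proof -
  have "\<exists>h\<in>hyp_inf k. x \<circ> h \<in> sym_fin (k * n)"
    if "x \<in> sym_fin (k * N)" "block_support k (block_images k x) \<subseteq> {1..n}" for N x
    using that
  proof (induction N arbitrary: x)
    case 0
    then show ?case
      using sym_fin_mono[of "k * 0" "k * n"] hyp_inf_id[OF k] by (intro bexI[of _ id]) auto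
  next
    case (Suc N)
    show ?case
    proof (cases "Suc N \<le> n")
      case True
      then have "x \<in> sym_fin (k * n)"
        using Suc.prems(1) sym_fin_mono mult_le_mono2 by blast
      then show ?thesis using hyp_inf_id[OF k] by (intro bexI[of _ id]) auto
    next
      case False
      then have "block k (Suc N) \<in> block_images k x"
        using Suc.prems(2) by (auto simp: block_support_def)
      then obtain h where h: "h \<in> hyp_inf k" "x \<circ> h \<in> sym_fin (k * N)"
        using hyp_inf_descend_step[OF Suc.prems(1)] by blast
      have "block_support k (block_images k (x \<circ> h)) \<subseteq> {1..n}"
        using Suc.prems(2) unfolding block_images_comp_hyp[OF k h(1)] .
      then obtain h' where "h' \<in> hyp_inf k" "x \<circ> h \<circ> h' \<in> sym_fin (k * n)"
        using Suc.IH[OF h(2)] by blast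
      then show ?thesis
        by (intro bexI[of _ "h \<circ> h'"] hyp_inf_comp[OF k h(1)]) (simp only: o_assoc)
    qed
  qed
  moreover obtain N where "x \<in> sym_fin (k * N)"
    using sym_inf_mono_obtains[OF k assms(1)] by blast
  ultimately show thesis using assms(2) that by blast
qed

end

subsection \<open>Structure coefficients as numbers of block partitions\<close>

text \<open>The left cosets in \<open>M\<close> whose members \<open>x\<close> satisfy
  \<open>inv x \<circ> g \<in> N\<close>, recorded as partitions without reference to
  \<open>n\<close>; the dependence on \<open>n\<close> enters only through the supports.\<close>

definition coset_factors ::
    "nat \<Rightarrow> (nat \<Rightarrow> nat) set \<Rightarrow> (nat \<Rightarrow> nat) set \<Rightarrow> (nat \<Rightarrow> nat) \<Rightarrow> nat set set set" where
  "coset_factors k M N g = {block_images k x | x y. x \<in> M \<and> y \<in> N \<and> x \<circ> y = g}"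

definition coset_factors_at ::
    "nat \<Rightarrow> (nat \<Rightarrow> nat) set \<Rightarrow> (nat \<Rightarrow> nat) set \<Rightarrow> (nat \<Rightarrow> nat) \<Rightarrow> nat \<Rightarrow> nat set set set" where
  "coset_factors_at k M N g n = {\<pi> \<in> coset_factors k M N g. block_support k \<pi> \<subseteq> {1..n}}"

definition factor_pairs ::
    "nat \<Rightarrow> (nat \<Rightarrow> nat) set \<Rightarrow> (nat \<Rightarrow> nat) set \<Rightarrow> (nat \<Rightarrow> nat) \<Rightarrow> nat \<Rightarrow>
      ((nat \<Rightarrow> nat) \<times> (nat \<Rightarrow> nat)) set" where
  "factor_pairs k M N g n = {(x, y). x \<in> dc_part k M n \<and> y \<in> dc_part k N n \<and> x \<circ> y = g}"

lemma finite_factor_pairs: "finite (factor_pairs k M N g n)"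
  by (rule finite_subset[of _ "sym_fin (k * n) \<times> sym_fin (k * n)"])
    (auto simp: factor_pairs_def dc_part_def finite_sym_fin)

lemma ga_mult_dc_sum:
  "ga_mult (sym_fin (k * n)) (dc_sum k M n) (dc_sum k N n) g =
    of_nat (card (factor_pairs k M N g n)) / of_nat (card (hyp_fin k n)) ^ 2"
proof -
  let ?S = "{(x, y) \<in> sym_fin (k * n) \<times> sym_fin (k * n). x \<circ> y = g}"
  let ?H = "of_nat (card (hyp_fin k n)) :: complex"
  have "finite ?S"
    by (rule finite_subset[of _ "sym_fin (k * n) \<times> sym_fin (k * n)"])
      (auto simp: finite_sym_fin)
  have "ga_mult (sym_fin (k * n)) (dc_sum k M n) (dc_sum k N n) g =
      (\<Sum>p\<in>?S. of_bool (p \<in> factor_pairs k M N g n) / ?H ^ 2)"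
    unfolding ga_mult_def dc_sum_def
    by (intro sum.cong) (auto simp: factor_pairs_def power2_eq_square)
  also have "\<dots> = of_nat (card (factor_pairs k M N g n)) / ?H ^ 2"
  proof -
    have "{p \<in> ?S. p \<in> factor_pairs k M N g n} = factor_pairs k M N g n"
      by (auto simp: factor_pairs_def dc_part_def)
    then have "(\<Sum>p\<in>?S. of_bool (p \<in> factor_pairs k M N g n)) =
        (of_nat (card (factor_pairs k M N g n)) :: complex)"
      using \<open>finite ?S\<close> by (simp add: of_bool_def sum.inter_filter[symmetric])
    then show ?thesis by (simp add: sum_divide_distrib[symmetric])
  qed
  finally show ?thesis .
qed

lemma sym_fin_cancel_left:
  assumes "x \<in> sym_fin n" "x \<circ> y \<in> sym_fin n"
  shows "y \<in> sym_fin n"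
proof -
  have "inv x \<circ> (x \<circ> y) = y"
    using sym_fin_in_sym_inf[OF assms(1)] by (simp add: o_assoc)
  then show ?thesis using sym_fin_comp[OF sym_fin_inv[OF assms(1)] assms(2)] by simp
qed

context
  fixes k :: nat and M N :: "(nat \<Rightarrow> nat) set"
  assumes k: "1 \<le> k" and M: "M \<in> double_cosets k" and N: "N \<in> double_cosets k"
begin

text \<open>Replacing \<open>(x, y)\<close> by \<open>(x \<circ> h, inv h \<circ> y)\<close>, with
  \<open>h\<close> from \<open>hyp_inf_descend\<close>, moves a factorisation into the finite group
  and changes neither product nor partition.\<close>

lemma coset_factors_at_eq:
  assumes g: "g \<in> sym_fin (k * n)"
  shows "coset_factors_at k M N g n = (\<lambda>(x, y). block_images k x) ` factor_pairs k M N g n"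
proof (intro equalityI subsetI)
  fix \<pi> assume "\<pi> \<in> coset_factors_at k M N g n"
  then obtain x y where xy: "\<pi> = block_images k x" "x \<in> M" "y \<in> N" "x \<circ> y = g"
    and supp: "block_support k (block_images k x) \<subseteq> {1..n}"
    by (auto simp: coset_factors_at_def coset_factors_def)
  obtain h where h: "h \<in> hyp_inf k" "x \<circ> h \<in> sym_fin (k * n)"
    using hyp_inf_descend[OF k double_coset_sym[OF k M xy(2)] supp] .
  have eq: "(x \<circ> h) \<circ> (inv h \<circ> y) = g"
  proof -
    have "(x \<circ> h) \<circ> (inv h \<circ> y) = x \<circ> (h \<circ> inv h) \<circ> y"
      by (simp only: o_assoc)
    then show ?thesis using hyp_inf_sym[OF k h(1)] xy by simp
  qed
  have "inv h \<circ> y \<in> sym_fin (k * n)"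
    using sym_fin_cancel_left[OF h(2)] eq g by metis
  then have "(x \<circ> h, inv h \<circ> y) \<in> factor_pairs k M N g n"
    using h eq double_coset_mult_right[OF k M xy(2) h(1)]
      double_coset_mult_left[OF k N xy(3) hyp_inf_inv[OF k h(1)]]
    by (simp add: factor_pairs_def dc_part_def)
  then show "\<pi> \<in> (\<lambda>(x, y). block_images k x) ` factor_pairs k M N g n"
    unfolding xy(1) block_images_comp_hyp[OF k h(1), of x, symmetric] by force
next
  fix \<pi> assume "\<pi> \<in> (\<lambda>(x, y). block_images k x) ` factor_pairs k M N g n"
  then show "\<pi> \<in> coset_factors_at k M N g n"
    using block_support_sym_fin[OF k]
    by (fastforce simp: coset_factors_at_def coset_factors_def factor_pairs_def dc_part_def)
qed

lemma finite_coset_factors_at: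
  "g \<in> sym_fin (k * n) \<Longrightarrow> finite (coset_factors_at k M N g n)"
  by (simp add: coset_factors_at_eq finite_factor_pairs)

text \<open>\<open>hyp_fin k n\<close> acts freely on the pairs by
  \<open>(x \<circ> h, inv h \<circ> y)\<close>, and the orbits are the fibres of the map to
  partitions.\<close>

lemma card_factor_pairs:
  assumes g: "g \<in> sym_fin (k * n)"
  shows "card (factor_pairs k M N g n) = card (coset_factors_at k M N g n) * card (hyp_fin k n)"
proof -
  let ?D = "factor_pairs k M N g n" and ?f = "\<lambda>(x, y). block_images k x"
  have fiber: "card {p \<in> ?D. ?f p = \<pi>} = card (hyp_fin k n)" if \<pi>: "\<pi> \<in> ?f ` ?D" for \<pi>
  proof -
    obtain x y where xy: "(x, y) \<in> ?D" "block_images k x = \<pi>" using \<pi> by auto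
    then have x: "x \<in> M" "x \<in> sym_fin (k * n)" and y: "y \<in> N" "y \<in> sym_fin (k * n)"
      and g: "x \<circ> y = g" by (auto simp: factor_pairs_def dc_part_def)
    have xs: "x \<in> sym_inf" using x(2) by (rule sym_fin_in_sym_inf)
    have "bij_betw (\<lambda>h. (x \<circ> h, inv h \<circ> y)) (hyp_fin k n) {p \<in> ?D. ?f p = \<pi>}"
    proof (rule bij_betwI')
      fix h h'
      have "inv x \<circ> (x \<circ> h) = h" for h using xs by (simp add: o_assoc)
      then show "((x \<circ> h, inv h \<circ> y) = (x \<circ> h', inv h' \<circ> y)) = (h = h')"
        by (metis prod.inject)
    next
      fix h assume "h \<in> hyp_fin k n"
      then have h: "h \<in> hyp_inf k" "h \<in> sym_fin (k * n)" by (auto simp: hyp_fin_def)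
      have "(x \<circ> h) \<circ> (inv h \<circ> y) = x \<circ> (h \<circ> inv h) \<circ> y" by (simp only: o_assoc)
      then have "(x \<circ> h) \<circ> (inv h \<circ> y) = g" using hyp_inf_sym[OF k h(1)] g by simp
      then show "(x \<circ> h, inv h \<circ> y) \<in> {p \<in> ?D. ?f p = \<pi>}"
        using xy(2) h x y double_coset_mult_right[OF k M x(1) h(1)] block_images_comp_hyp[OF k h(1)]
          double_coset_mult_left[OF k N y(1) hyp_inf_inv[OF k h(1)]]
        by (simp add: factor_pairs_def dc_part_def sym_fin_comp sym_fin_inv)
    next
      fix p assume "p \<in> {p \<in> ?D. ?f p = \<pi>}"
      then obtain a b where p: "p = (a, b)" and a: "a \<in> sym_fin (k * n)" "a \<circ> b = g"
        and eq: "block_images k x = block_images k a"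
        using xy(2) by (auto simp: factor_pairs_def dc_part_def)
      have as: "a \<in> sym_inf" using a(1) by (rule sym_fin_in_sym_inf)
      let ?h = "inv x \<circ> a"
      have "?h \<in> hyp_inf k" using eq block_images_eq_iff[OF k xs as] by simp
      then have "?h \<in> hyp_fin k n"
        using x a by (simp add: hyp_fin_def sym_fin_comp sym_fin_inv)
      moreover have "x \<circ> ?h = a" using xs by (simp add: o_assoc)
      moreover have "inv ?h \<circ> y = b"
      proof -
        have "inv ?h = inv a \<circ> x"
          using sym_inf_bij[OF sym_inf_inv[OF xs]] sym_inf_bij[OF as] sym_inf_bij[OF xs]
          by (simp add: o_inv_distrib inv_inv_eq)
        then have "inv ?h \<circ> y = inv a \<circ> (a \<circ> b)" using g a by (simp add: o_assoc[symmetric])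
        then show ?thesis using as by (simp add: o_assoc)
      qed
      ultimately show "\<exists>h\<in>hyp_fin k n. p = (x \<circ> h, inv h \<circ> y)" using p by metis
    qed
    from bij_betw_same_card[OF this] show ?thesis by simp
  qed
  have "(\<Sum>p\<in>?D. 1::nat) = (\<Sum>\<pi>\<in>?f ` ?D. \<Sum>p | p \<in> ?D \<and> ?f p = \<pi>. 1)"
    using finite_factor_pairs by (rule sum.image_gen)
  then have "card ?D = (\<Sum>\<pi>\<in>?f ` ?D. card {p \<in> ?D. ?f p = \<pi>})" by simp
  then show ?thesis using fiber by (simp add: coset_factors_at_eq[OF g])
qed

text \<open>All elements of \<open>M\<close> miss equally many standard blocks, so any single one
  supplies the bound.\<close>

lemma card_block_support_bounded:
  obtains a where "\<And>\<pi>. \<pi> \<in> coset_factors k M N g \<Longrightarrow>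
    finite (block_support k \<pi>) \<and> card (block_support k \<pi>) \<le> a"
proof (cases "M = {}")
  case True
  then show thesis using that by (simp add: coset_factors_def)
next
  case False
  then obtain x0 where x0: "x0 \<in> M" by blast
  show thesis
  proof (rule that[of "card (block_support k (block_images k x0))"])
    fix \<pi> assume "\<pi> \<in> coset_factors k M N g"
    then obtain x where x: "x \<in> M" "\<pi> = block_images k x" by (auto simp: coset_factors_def)
    then show "finite (block_support k \<pi>) \<and>
        card (block_support k \<pi>) \<le> card (block_support k (block_images k x0))"
      using finite_block_support[OF k double_coset_sym[OF k M x(1)]]
        card_block_support_double_coset[OF k M x(1) x0] by simp
  qed
qed

text \<open>The lift fixes everything up to \<open>k * m\<close> and \<open>g\<close> fixes
  everything beyond, so they commute and \<open>(?h \<circ> x, y \<circ> inv ?h)\<close> is again a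
  factorisation of \<open>g\<close>.\<close>

lemma block_lift_coset_factors:
  assumes g: "g \<in> sym_fin (k * m)" and \<sigma>: "\<sigma> permutes {1..n}" "\<And>i. i \<le> m \<Longrightarrow> \<sigma> i = i"
    and \<pi>: "\<pi> \<in> coset_factors k M N g"
  shows "(`) (block_lift k \<sigma>) ` \<pi> \<in> coset_factors k M N g"
    and "block_support k ((`) (block_lift k \<sigma>) ` \<pi>) = \<sigma> ` block_support k \<pi>"
proof -
  let ?h = "block_lift k \<sigma>"
  have h: "?h \<in> hyp_inf k" by (rule block_lift_hyp[OF k \<sigma>(1)])
  obtain x y where xy: "\<pi> = block_images k x" "x \<in> M" "y \<in> N" "x \<circ> y = g"
    using \<pi> by (auto simp: coset_factors_def)
  have fix_h: "?h r = r" if "r \<le> k * m" for r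
  proof (cases "r = 0")
    case False
    then have "block_index k r \<le> m" using block_index_le_iff[OF k] that by simp
    then show ?thesis using False \<sigma>(2) by (intro block_lift_fix[OF k]) auto
  qed (simp add: block_lift_def)
  have comm: "?h \<circ> g = g \<circ> ?h"
  proof
    fix r
    have gr: "g r \<le> k * m \<longleftrightarrow> r \<le> k * m" for r
      using g permutes_in_image[of g "{1..k * m}" r] permutes_not_in[of g "{1..k * m}" r]
      by (cases "r \<in> {1..k * m}") (auto simp: sym_fin_def)
    show "(?h \<circ> g) r = (g \<circ> ?h) r"
    proof (cases "r \<le> k * m")
      case True
      then show ?thesis using fix_h gr by simp
    next
      case False
      have "\<not> ?h r \<le> k * m"
        using False fix_h sym_inf_inj[OF hyp_inf_sym[OF k h]] by (metis injD)
      then show ?thesis using False sym_fin_fix[OF g] by simp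
    qed
  qed
  have "(?h \<circ> x) \<circ> (y \<circ> inv ?h) = g"
  proof -
    have "(?h \<circ> x) \<circ> (y \<circ> inv ?h) = ?h \<circ> (x \<circ> y) \<circ> inv ?h" by (simp only: o_assoc)
    also have "\<dots> = g \<circ> (?h \<circ> inv ?h)" by (simp only: xy(4) comm o_assoc)
    finally show ?thesis using hyp_inf_sym[OF k h] by simp
  qed
  moreover have "?h \<circ> x \<in> M" "y \<circ> inv ?h \<in> N"
    using double_coset_mult_left[OF k M xy(2) h]
      double_coset_mult_right[OF k N xy(3) hyp_inf_inv[OF k h]] by auto
  ultimately have "block_images k (?h \<circ> x) \<in> coset_factors k M N g"
    unfolding coset_factors_def by blast
  then show "(`) ?h ` \<pi> \<in> coset_factors k M N g"
    by (simp add: xy(1) block_images_comp)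
  show "block_support k ((`) ?h ` \<pi>) = \<sigma> ` block_support k \<pi>"
    using block_support_lift[OF k \<sigma>(1), of x] by (simp add: xy(1) block_images_comp)
qed

section \<open>Polynomial dependence of the count on n\<close>

definition level :: "(nat \<Rightarrow> nat) \<Rightarrow> nat \<Rightarrow> nat set \<Rightarrow> nat set set set" where
  "level g m T = {\<pi> \<in> coset_factors k M N g. block_support k \<pi> - {1..m} = T}"

lemma finite_level:
  assumes g: "g \<in> sym_fin (k * m)" and "finite T" shows "finite (level g m T)"
proof -
  define n where "n = Max (insert m T)"
  have n: "m \<le> n" "T \<subseteq> {..n}" using assms(2) by (auto simp: n_def)
  have "level g m T \<subseteq> coset_factors_at k M N g n"
  proof
    fix \<pi> assume \<pi>: "\<pi> \<in> level g m T"
    have "block_support k \<pi> \<subseteq> {1..}" by (auto simp: block_support_def)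
    with \<pi> n show "\<pi> \<in> coset_factors_at k M N g n"
      by (fastforce simp: level_def coset_factors_at_def)
  qed
  moreover have "g \<in> sym_fin (k * n)" using g n sym_fin_mono mult_le_mono2 by blast
  ultimately show ?thesis using finite_coset_factors_at finite_subset by blast
qed

text \<open>A permutation carrying \<open>T\<close> to \<open>T'\<close> and fixing the indices up
  to \<open>m\<close> lifts to an injection between the levels. The hypotheses are symmetric, so
  exchanging \<open>T\<close> and \<open>T'\<close> yields equality.\<close>

lemma card_level_le:
  assumes g: "g \<in> sym_fin (k * m)"
    and T: "finite T" "T \<subseteq> {m<..}" "finite T'" "T' \<subseteq> {m<..}" "card T = card T'"
  shows "card (level g m T) \<le> card (level g m T')"
proof -
  obtain \<sigma> where \<sigma>: "\<sigma> permutes (T \<union> T')" "\<sigma> ` T = T'"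
    using ex_permutes_image[OF T(1,3,5)] .
  define n where "n = Max (insert m (T \<union> T'))"
  have "T \<union> T' \<subseteq> {..n}" unfolding n_def using T by auto
  then have "T \<union> T' \<subseteq> {1..n}" using T by fastforce
  then have \<sigma>n: "\<sigma> permutes {1..n}" using \<sigma>(1) permutes_subset by blast
  have \<sigma>m: "\<sigma> i = i" if "i \<le> m" for i
  proof -
    have "i \<notin> T \<union> T'" using that T by auto
    then show ?thesis using \<sigma>(1) by (simp add: permutes_def)
  qed
  have \<sigma>im: "\<sigma> ` {1..m} = {1..m}"
    using \<sigma>m by (intro trans[OF image_cong image_ident]) auto
  have inj: "inj \<sigma>" by (rule permutes_inj[OF \<sigma>(1)])
  let ?F = "\<lambda>\<pi>. (`) (block_lift k \<sigma>) ` \<pi>"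
  have "inj ((`) (block_lift k \<sigma>))"
    by (rule inj_image_sym[OF hyp_inf_sym[OF k block_lift_hyp[OF k \<sigma>n]]])
  then have "inj ?F" by (rule inj_image)
  moreover have "?F ` level g m T \<subseteq> level g m T'"
  proof
    fix \<rho> assume "\<rho> \<in> ?F ` level g m T"
    then obtain \<pi> where \<pi>: "\<rho> = ?F \<pi>" "\<pi> \<in> coset_factors k M N g"
      "block_support k \<pi> - {1..m} = T"
      by (auto simp: level_def)
    have lift: "?F \<pi> \<in> coset_factors k M N g"
      "block_support k (?F \<pi>) = \<sigma> ` block_support k \<pi>"
      using block_lift_coset_factors[OF g \<sigma>n _ \<pi>(2)] \<sigma>m by blast+
    have "block_support k \<rho> - {1..m} = \<sigma> ` (block_support k \<pi> - {1..m})"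
      unfolding \<pi>(1) lift(2) by (simp only: image_set_diff[OF inj] \<sigma>im)
    then show "\<rho> \<in> level g m T'"
      using lift(1) \<pi> \<sigma>(2) by (simp add: level_def)
  qed
  ultimately show ?thesis
    using finite_level[OF g T(3)] by (meson card_inj_on_le inj_on_subset subset_UNIV)
qed

lemma card_coset_factors_at_poly:
  assumes g: "g \<in> sym_fin (k * m)"
  obtains P :: "complex poly"
  where "\<And>n. m \<le> n \<Longrightarrow> of_nat (card (coset_factors_at k M N g n)) = poly P (of_nat n)"
proof -
  obtain a where a: "\<And>\<pi>. \<pi> \<in> coset_factors k M N g \<Longrightarrow>
      finite (block_support k \<pi>) \<and> card (block_support k \<pi>) \<le> a"
    using card_block_support_bounded[of g] by blast
  \<comment> \<open>\<open>{m<..m + t}\<close> is a sample \<open>t\<close>-subset of the indices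
    beyond \<open>m\<close>; by \<open>card_level_le\<close> every other one gives the same
    count.\<close>
  define f where "f t = card (level g m {m<..m + t})" for t
  have f: "card (level g m T) = f (card T)" if "finite T" "T \<subseteq> {m<..}" for T
    unfolding f_def by (intro antisym card_level_le[OF g]) (use that in auto)
  \<comment> \<open>No factor misses more than \<open>a\<close> standard blocks, so the range of
    \<open>t\<close> is bounded independently of \<open>n\<close>.\<close>
  have f0: "f t = 0" if "a < t" for t
  proof -
    have "\<pi> \<notin> level g m {m<..m + t}" for \<pi>
    proof
      assume "\<pi> \<in> level g m {m<..m + t}"
      then have "{m<..m + t} \<subseteq> block_support k \<pi>" and "\<pi> \<in> coset_factors k M N g"
        by (auto simp: level_def)
      then have "card {m<..m + t} \<le> a" using a card_mono order_trans by metis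
      then show False using that by simp
    qed
    then show ?thesis unfolding f_def by (metis card.empty equals0I)
  qed
  have "\<exists>Q. \<forall>n\<ge>m. poly Q (of_nat n) = (of_nat ((n - m) choose t) :: complex)" for t
    by (metis binomial_poly)
  then obtain Q where Q: "\<And>t n. m \<le> n \<Longrightarrow> poly (Q t) (of_nat n) = (of_nat ((n - m) choose t) :: complex)"
    by metis
  show thesis
  proof (rule that[of "\<Sum>t\<le>a. smult (of_nat (f t)) (Q t)"])
    fix n assume n: "m \<le> n"
    have "coset_factors_at k M N g n = (\<Union>T\<in>Pow {m<..n}. level g m T)"
    proof -
      have "block_support k \<pi> - {1..m} \<subseteq> {m<..n} \<longleftrightarrow> block_support k \<pi> \<subseteq> {1..n}" for \<pi>
      proof -
        have "block_support k \<pi> \<subseteq> {1..}" by (auto simp: block_support_def)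
        then show ?thesis using n by (auto simp: subset_iff Suc_le_eq not_le intro: order_trans)
      qed
      then show ?thesis unfolding coset_factors_at_def level_def by blast
    qed
    \<comment> \<open>The levels are disjoint because a partition determines its
      \<open>T\<close>.\<close>
    then have "card (coset_factors_at k M N g n) = (\<Sum>T\<in>Pow {m<..n}. card (level g m T))"
    proof (simp only:, intro card_UN_disjoint ballI impI)
      fix T assume "T \<in> Pow {m<..n}"
      then have "finite T" by (simp add: finite_subset)
      then show "finite (level g m T)" by (rule finite_level[OF g])
    qed (auto simp: level_def)
    also have "\<dots> = (\<Sum>T\<in>Pow {m<..n}. f (card T))"
    proof (intro sum.cong refl)
      fix T assume "T \<in> Pow {m<..n}"
      then have "finite T" "T \<subseteq> {m<..}" using finite_subset by auto
      then show "card (level g m T) = f (card T)" by (rule f)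
    qed
    also have "\<dots> = (\<Sum>t\<le>a. (card {m<..n} choose t) * f t)"
      using f0 by (intro sum_Pow_card) auto
    finally show "of_nat (card (coset_factors_at k M N g n)) =
        poly (\<Sum>t\<le>a. smult (of_nat (f t)) (Q t)) (of_nat n)"
      using Q[OF n] by (simp add: poly_sum mult.commute)
  qed
qed

section \<open>Independence of the element chosen in L(n)\<close>

text \<open>Left translation by \<open>h\<close> is injective on partitions, and the second factor
  absorbs \<open>h'\<close>. The reverse inequality is the same statement for \<open>inv h\<close>
  and \<open>inv h'\<close>.\<close>

lemma card_coset_factors_at_hyp_le:
  assumes g: "g \<in> sym_fin (k * n)" and h: "h \<in> hyp_inf k" "h' \<in> hyp_inf k"
    and hn: "h \<in> sym_fin (k * n)" "h' \<in> sym_fin (k * n)"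
  shows "card (coset_factors_at k M N g n) \<le> card (coset_factors_at k M N (h \<circ> g \<circ> h') n)"
proof (rule card_inj_on_le)
  have g': "h \<circ> g \<circ> h' \<in> sym_fin (k * n)" using g hn by (simp add: sym_fin_comp)
  let ?F = "\<lambda>\<pi>. (`) h ` \<pi>"
  have "inj ((`) h)" by (rule inj_image_sym[OF hyp_inf_sym[OF k h(1)]])
  then have "inj ?F" by (rule inj_image)
  then show "inj_on ?F (coset_factors_at k M N g n)" by (rule inj_on_subset) simp
  show "finite (coset_factors_at k M N (h \<circ> g \<circ> h') n)" by (rule finite_coset_factors_at[OF g'])
  show "?F ` coset_factors_at k M N g n \<subseteq> coset_factors_at k M N (h \<circ> g \<circ> h') n"
  proof
    fix \<rho> assume "\<rho> \<in> ?F ` coset_factors_at k M N g n"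
    then obtain x y where xy: "\<rho> = ?F (block_images k x)" "(x, y) \<in> factor_pairs k M N g n"
      unfolding coset_factors_at_eq[OF g] by auto
    have "h \<circ> x \<circ> (y \<circ> h') = h \<circ> (x \<circ> y) \<circ> h'" by (simp only: o_assoc)
    then have "(h \<circ> x, y \<circ> h') \<in> factor_pairs k M N (h \<circ> g \<circ> h') n"
      using xy(2) hn double_coset_mult_left[OF k M _ h(1)] double_coset_mult_right[OF k N _ h(2)]
      by (simp add: factor_pairs_def dc_part_def sym_fin_comp)
    moreover have "\<rho> = block_images k (h \<circ> x)" by (simp add: xy(1) block_images_comp)
    ultimately show "\<rho> \<in> coset_factors_at k M N (h \<circ> g \<circ> h') n"
      unfolding coset_factors_at_eq[OF g'] by force
  qed
qed

text \<open>The conjugating elements \<open>h\<close>, \<open>h'\<close> need not lie in \<open>S\<^bsub>kn\<^esub>\<close>; but they do so for large \<open>n\<close>, and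
  both sides are polynomials in \<open>n\<close>.\<close>

lemma card_coset_factors_at_double_coset:
  assumes L: "L \<in> double_cosets k" and g: "g \<in> dc_part k L n" and g': "g' \<in> dc_part k L n"
  shows "card (coset_factors_at k M N g n) = card (coset_factors_at k M N g' n)"
proof -
  have gn: "g \<in> L" "g \<in> sym_fin (k * n)" "g' \<in> L" "g' \<in> sym_fin (k * n)"
    using g g' by (auto simp: dc_part_def)
  obtain P where P: "\<And>n'. n \<le> n' \<Longrightarrow>
      of_nat (card (coset_factors_at k M N g n')) = poly P (of_nat n' :: complex)"
    using card_coset_factors_at_poly[OF gn(2)] by blast
  obtain P' where P': "\<And>n'. n \<le> n' \<Longrightarrow>
      of_nat (card (coset_factors_at k M N g' n')) = poly P' (of_nat n' :: complex)"
    using card_coset_factors_at_poly[OF gn(4)] by blast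
  obtain h h' where h: "h \<in> hyp_inf k" "h' \<in> hyp_inf k" "g' = h \<circ> g \<circ> h'"
    using double_coset_obtains[OF k L gn(1,3)] .
  obtain m where m: "\<And>n'. m \<le> n' \<Longrightarrow> h \<in> sym_fin (k * n')"
    using sym_inf_mono_obtains[OF k hyp_inf_sym[OF k h(1)]] by blast
  obtain m' where m': "\<And>n'. m' \<le> n' \<Longrightarrow> h' \<in> sym_fin (k * n')"
    using sym_inf_mono_obtains[OF k hyp_inf_sym[OF k h(2)]] by blast
  define b where "b = Max {m, m', n}"
  have eq: "poly P (of_nat n') = poly P' (of_nat n')" if "b \<le> n'" for n'
  proof -
    have le: "m \<le> n'" "m' \<le> n'" "n \<le> n'" using that by (auto simp: b_def)
    have mono: "sym_fin (k * n) \<subseteq> sym_fin (k * n')" using le by (intro sym_fin_mono) simp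
    have "inv h \<circ> g' \<circ> inv h' = (inv h \<circ> h) \<circ> g \<circ> (h' \<circ> inv h')"
      unfolding h(3) by (simp only: o_assoc)
    then have "g = inv h \<circ> g' \<circ> inv h'" using h(1,2) hyp_inf_sym[OF k] by simp
    then have "card (coset_factors_at k M N g' n') \<le> card (coset_factors_at k M N g n')"
      using card_coset_factors_at_hyp_le[of g' n' "inv h" "inv h'"] gn(4) mono h m m' le
        hyp_inf_inv[OF k] sym_fin_inv by auto
    moreover have "card (coset_factors_at k M N g n') \<le> card (coset_factors_at k M N g' n')"
      using card_coset_factors_at_hyp_le[of g n' h h'] gn(2) mono h m m' le by auto
    ultimately show ?thesis using P P' le by (metis le_antisym)
  qed
  \<comment> \<open>Otherwise the difference would have every integer from \<open>b\<close> on as a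
    root. Equality of the polynomials carries the comparison back to \<open>n\<close>, which may be
    smaller than \<open>b\<close>.\<close>
  have "P = P'"
  proof (rule ccontr)
    assume "P \<noteq> P'"
    then have "finite {z. poly (P - P') z = 0}" by (intro poly_roots_finite) simp
    moreover have "of_nat ` {b..} \<subseteq> {z. poly (P - P') z = 0}" using eq by auto
    ultimately have "finite (of_nat ` {b..} :: complex set)" using finite_subset by blast
    then have "finite {b..}" by (rule finite_imageD) (simp add: inj_on_def)
    then show False using infinite_Ici by blast
  qed
  then have "of_nat (card (coset_factors_at k M N g n)) =
      (of_nat (card (coset_factors_at k M N g' n)) :: complex)"
    using P P' by simp
  then show ?thesis by simp
qed

section \<open>Identification of the structure coefficients\<close>

lemma card_hyp_fin: "card (hyp_fin k n) \<noteq> 0"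
proof -
  have "finite (hyp_fin k n)" by (simp add: hyp_fin_def finite_sym_fin)
  moreover have "id \<in> hyp_fin k n" by (simp add: hyp_fin_def hyp_inf_id[OF k])
  ultimately show ?thesis by auto
qed

lemma dc_sum_expansion:
  assumes L: "L \<in> double_cosets_at k n" "g \<in> dc_part k L n"
  shows "(\<Sum>L'\<in>double_cosets_at k n. c L' * dc_sum k L' n g) = c L / of_nat (card (hyp_fin k n))"
proof -
  have "dc_sum k L' n g = (if L' = L then 1 / of_nat (card (hyp_fin k n)) else 0)"
    if "L' \<in> double_cosets_at k n" for L'
  proof (cases "L' = L")
    case False
    then have "g \<notin> dc_part k L' n"
      using double_coset_eq[OF k, of L' L g] L that by (auto simp: dc_part_def double_cosets_at_def)
    then show ?thesis using False by (simp add: dc_sum_def)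
  qed (use L in \<open>simp add: dc_sum_def\<close>)
  then have "(\<Sum>L'\<in>double_cosets_at k n. c L' * dc_sum k L' n g) =
      (\<Sum>L'\<in>double_cosets_at k n. if L' = L then c L' / of_nat (card (hyp_fin k n)) else 0)"
    by (intro sum.cong) auto
  also have "\<dots> = c L / of_nat (card (hyp_fin k n))"
    using L finite_double_cosets_at[OF k, of n] by (simp add: sum.delta)
  finally show ?thesis .
qed

text \<open>By \<open>card_factor_pairs\<close> one factor \<open>card (hyp_fin k n)\<close> cancels
  from the coefficient of the product at \<open>g\<close>, and the other matches the normalisation
  of \<open>dc_sum\<close>. Evaluation at an element of each double coset gives existence and
  uniqueness of the expansion.\<close>

lemma struct_coeff_eq:
  assumes L: "L \<in> double_cosets k" and g: "g \<in> dc_part k L n"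
  shows "struct_coeff k M N L n = of_nat (card (coset_factors_at k M N g n))"
proof -
  let ?H = "of_nat (card (hyp_fin k n)) :: complex"
  have H: "?H \<noteq> 0" using card_hyp_fin by simp
  \<comment> \<open>The choice of representative is immaterial by
    \<open>card_coset_factors_at_double_coset\<close>; the default \<open>0\<close> is what
    \<open>is_expansion\<close> demands off the index set.\<close>
  define c :: "(nat \<Rightarrow> nat) set \<Rightarrow> complex" where
    "c L = (if L \<in> double_cosets_at k n
      then of_nat (card (coset_factors_at k M N (SOME g. g \<in> dc_part k L n) n)) else 0)" for L
  have c: "c L = of_nat (card (coset_factors_at k M N g n))"
    if "L \<in> double_cosets k" "g \<in> dc_part k L n" for L g
  proof -
    have "(SOME g. g \<in> dc_part k L n) \<in> dc_part k L n" using that(2) some_in_eq[of "dc_part k L n"] by blast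
    from card_coset_factors_at_double_coset[OF that(1) this that(2)]
    have "card (coset_factors_at k M N (SOME g. g \<in> dc_part k L n) n) =
      card (coset_factors_at k M N g n)" .
    moreover have "L \<in> double_cosets_at k n" using that by (auto simp: double_cosets_at_def)
    ultimately show ?thesis by (simp only: c_def if_True)
  qed
  have prod: "ga_mult (sym_fin (k * n)) (dc_sum k M n) (dc_sum k N n) g =
      of_nat (card (coset_factors_at k M N g n)) / ?H" if "g \<in> sym_fin (k * n)" for g
    using H by (simp add: ga_mult_dc_sum card_factor_pairs[OF that] power2_eq_square)
  have "(THE c. is_expansion k M N n c) = c"
  proof (rule the_equality)
    show "is_expansion k M N n c" unfolding is_expansion_def
    proof (intro conjI ext)
      show "\<forall>L. L \<notin> double_cosets_at k n \<longrightarrow> c L = 0" by (simp add: c_def)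
      fix g
      show "ga_mult (sym_fin (k * n)) (dc_sum k M n) (dc_sum k N n) g =
          (\<Sum>L\<in>double_cosets_at k n. c L * dc_sum k L n g)"
      proof (cases "g \<in> sym_fin (k * n)")
        case True
        obtain L where "L \<in> double_cosets k" "g \<in> L"
          using double_coset_exists[OF k sym_fin_in_sym_inf[OF True]] .
        then have L: "L \<in> double_cosets_at k n" "g \<in> dc_part k L n" "L \<in> double_cosets k"
          using True by (auto simp: double_cosets_at_def dc_part_def)
        show ?thesis using dc_sum_expansion[OF L(1,2)] prod[OF True] c[OF L(3,2)] by simp
      next
        case False
        then have "factor_pairs k M N g n = {}"
          by (auto simp: factor_pairs_def dc_part_def sym_fin_comp)
        moreover have "dc_sum k L n g = 0" for L using False by (simp add: dc_sum_def dc_part_def)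
        ultimately show ?thesis by (simp add: ga_mult_dc_sum)
      qed
    qed
  next
    fix c' assume c': "is_expansion k M N n c'"
    show "c' = c"
    proof
      fix L
      show "c' L = c L"
      proof (cases "L \<in> double_cosets_at k n")
        case True
        then obtain g where g: "g \<in> dc_part k L n" "L \<in> double_cosets k" "g \<in> sym_fin (k * n)"
          by (auto simp: double_cosets_at_def dc_part_def)
        have "of_nat (card (coset_factors_at k M N g n)) / ?H = c' L / ?H"
          using fun_cong[OF conjunct2[OF c'[unfolded is_expansion_def]], of g]
          by (simp only: prod[OF g(3)] dc_sum_expansion[OF True g(1)])
        then show ?thesis using H c[OF g(2,1)] by simp
      next
        case False
        then show ?thesis using c' by (simp add: is_expansion_def c_def)
      qed
    qed
  qed
  then show ?thesis using c[OF L g] by (simp add: struct_coeff_def)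
qed

end

subsection \<open>Weights\<close>

text \<open>The saturated sets are the unions of classes, hence correspond to the subsets of
  \<open>V // R\<close>.\<close>

lemma card_saturated_sets:
  assumes "finite V" "equiv V R"
  shows "card {X. X \<subseteq> V \<and> (\<forall>(v, w)\<in>R. v \<in> X \<longleftrightarrow> w \<in> X)} = 2 ^ card (V // R)"
proof -
  let ?S = "{X. X \<subseteq> V \<and> (\<forall>(v, w)\<in>R. v \<in> X \<longleftrightarrow> w \<in> X)}"
  have sub: "C \<subseteq> V" if "C \<in> V // R" for C
    using that assms(2) by (meson in_quotient_imp_subset)
  have "bij_betw Union (Pow (V // R)) ?S"
  proof (rule bij_betw_byWitness[where f' = "\<lambda>X. {C \<in> V // R. C \<subseteq> X}"])
    show "\<forall>\<C>\<in>Pow (V // R). {C \<in> V // R. C \<subseteq> \<Union>\<C>} = \<C>"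
    proof (intro ballI equalityI subsetI)
      fix \<C> C assume \<C>: "\<C> \<in> Pow (V // R)" and C: "C \<in> {C \<in> V // R. C \<subseteq> \<Union>\<C>}"
      then obtain v where v: "v \<in> C" using in_quotient_imp_non_empty[OF assms(2)] by blast
      then obtain D where D: "D \<in> \<C>" "v \<in> D" using C by blast
      then have "C = D" using quotient_disj[OF assms(2), of C D] C \<C> v by blast
      then show "C \<in> \<C>" using D by simp
    qed auto
    show "\<forall>X\<in>?S. \<Union>{C \<in> V // R. C \<subseteq> X} = X"
    proof (intro ballI equalityI subsetI)
      fix X v assume X: "X \<in> ?S" and v: "v \<in> X"
      then have "R `` {v} \<subseteq> X" "R `` {v} \<in> V // R" "v \<in> R `` {v}"
        using equiv_class_self[OF assms(2)] by (auto intro: quotientI)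
      then show "v \<in> \<Union>{C \<in> V // R. C \<subseteq> X}" by blast
    qed auto
    show "Union ` Pow (V // R) \<subseteq> ?S"
    proof
      fix X assume "X \<in> Union ` Pow (V // R)"
      then obtain \<C> where \<C>: "X = \<Union>\<C>" "\<C> \<subseteq> V // R" by auto
      have closed: "w \<in> X" if vw: "(v, w) \<in> R" "v \<in> X" for v w
      proof -
        obtain C where "C \<in> \<C>" "v \<in> C" using vw(2) \<C>(1) by blast
        then have "w \<in> C" using in_quotient_imp_closed[OF assms(2) _ _ vw(1)] \<C>(2) by blast
        then show ?thesis using \<open>C \<in> \<C>\<close> \<C>(1) by blast
      qed
      have "v \<in> X \<longleftrightarrow> w \<in> X" if "(v, w) \<in> R" for v w
        using closed that equivE[OF assms(2)] by (metis symD)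
      then show "X \<in> ?S" using sub \<C> by blast
    qed
    show "(\<lambda>X. {C \<in> V // R. C \<subseteq> X}) ` ?S \<subseteq> Pow (V // R)" by auto
  qed
  then have "card ?S = card (Pow (V // R))" by (rule bij_betw_same_card[symmetric])
  also have "\<dots> = 2 ^ card (V // R)"
    using assms by (simp add: card_Pow finite_quotient equiv_type)
  finally show ?thesis .
qed

lemma sym_adjacency: "sym (adjacency G)"
  by (auto simp: sym_def adjacency_def insert_commute)

lemma equiv_components:
  "equiv (verts G) {(v, w) \<in> verts G \<times> verts G. (v, w) \<in> (adjacency G)\<^sup>*}"
proof (rule equivI)
  show "sym {(v, w) \<in> verts G \<times> verts G. (v, w) \<in> (adjacency G)\<^sup>*}"
    using symD[OF sym_rtrancl[OF sym_adjacency, of G]] by (intro symI) blast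
  show "trans {(v, w) \<in> verts G \<times> verts G. (v, w) \<in> (adjacency G)\<^sup>*}"
    by (intro transI) (blast intro: rtrancl_trans)
qed (auto intro: refl_onI)

text \<open>Closure under edges is closure under paths. Components are thus counted through vertex
  sets, which can be compared with unions of blocks.\<close>

lemma card_components:
  assumes "finite (verts G)" "adjacency G \<subseteq> verts G \<times> verts G"
  shows "card {X. X \<subseteq> verts G \<and> (\<forall>(v, w)\<in>adjacency G. v \<in> X \<longleftrightarrow> w \<in> X)} = 2 ^ card (components G)"
proof -
  let ?R = "{(v, w) \<in> verts G \<times> verts G. (v, w) \<in> (adjacency G)\<^sup>*}"
  have "(\<forall>(v, w)\<in>adjacency G. v \<in> X \<longleftrightarrow> w \<in> X) \<longleftrightarrow> (\<forall>(v, w)\<in>?R. v \<in> X \<longleftrightarrow> w \<in> X)" for X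
  proof
    assume X: "\<forall>(v, w)\<in>adjacency G. v \<in> X \<longleftrightarrow> w \<in> X"
    have "v \<in> X \<longleftrightarrow> w \<in> X" if "(v, w) \<in> (adjacency G)\<^sup>*" for v w
      using that by induction (use X in auto)
    then show "\<forall>(v, w)\<in>?R. v \<in> X \<longleftrightarrow> w \<in> X" by blast
  next
    assume "\<forall>(v, w)\<in>?R. v \<in> X \<longleftrightarrow> w \<in> X"
    then show "\<forall>(v, w)\<in>adjacency G. v \<in> X \<longleftrightarrow> w \<in> X" using assms(2) by blast
  qed
  then show ?thesis
    using card_saturated_sets[OF assms(1) equiv_components] by (simp add: components_def)
qed

section \<open>Families closed under symmetric difference\<close>

lemma sym_diff_cancel: "sym_diff A B = sym_diff A C \<Longrightarrow> B = C"
  by blast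

text \<open>The map sending \<open>(X, Y)\<close> to the symmetric difference of \<open>X\<close> and \<open>Y\<close> has fibres of
  size at most \<open>card (A \<inter> B)\<close>.\<close>

lemma card_Int_sym_diff_closed:
  assumes "finite C" "A \<subseteq> C" "B \<subseteq> C"
    and A: "\<And>X Y. X \<in> A \<Longrightarrow> Y \<in> A \<Longrightarrow> sym_diff X Y \<in> A"
    and B: "\<And>X Y. X \<in> B \<Longrightarrow> Y \<in> B \<Longrightarrow> sym_diff X Y \<in> B"
    and C: "\<And>X Y. X \<in> C \<Longrightarrow> Y \<in> C \<Longrightarrow> sym_diff X Y \<in> C"
  shows "card A * card B \<le> card C * card (A \<inter> B)"
proof -
  let ?d = "\<lambda>(X, Y). sym_diff X Y"
  have fin: "finite A" "finite B" using finite_subset[OF assms(2,1)] finite_subset[OF assms(3,1)] by auto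
  have fiber: "card {p \<in> A \<times> B. ?d p = Z} \<le> card (A \<inter> B)" for Z
  proof (cases "{p \<in> A \<times> B. ?d p = Z} = {}")
    case False
    then obtain X0 Y0 where X0: "X0 \<in> A" "Y0 \<in> B" "sym_diff X0 Y0 = Z" by auto
    \<comment> \<open>Translate the fibre by one of its members:
      \<open>sym_diff X Y = sym_diff X0 Y0\<close> gives
      \<open>sym_diff X X0 = sym_diff Y Y0\<close>, a set in both \<open>A\<close> and
      \<open>B\<close>; and \<open>X\<close> determines \<open>Y\<close> within the fibre.\<close>
    show ?thesis
    proof (rule card_inj_on_le[where f = "\<lambda>(X, Y). sym_diff X X0"])
      show "inj_on (\<lambda>(X, Y). sym_diff X X0) {p \<in> A \<times> B. ?d p = Z}"
      proof (rule inj_onI)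
        fix p q assume p: "p \<in> {p \<in> A \<times> B. ?d p = Z}" and q: "q \<in> {p \<in> A \<times> B. ?d p = Z}"
          and eq: "(\<lambda>(X, Y). sym_diff X X0) p = (\<lambda>(X, Y). sym_diff X X0) q"
        obtain X Y X' Y' where XY: "p = (X, Y)" "q = (X', Y')" by (cases p, cases q)
        then have "sym_diff X0 X = sym_diff X0 X'" using eq by (simp add: Un_commute)
        then have "X = X'" by (rule sym_diff_cancel)
        moreover have "sym_diff X Y = sym_diff X' Y'" using p q XY by simp
        ultimately show "p = q" using XY sym_diff_cancel by blast
      qed
      show "(\<lambda>(X, Y). sym_diff X X0) ` {p \<in> A \<times> B. ?d p = Z} \<subseteq> A \<inter> B"
      proof
        fix W assume "W \<in> (\<lambda>(X, Y). sym_diff X X0) ` {p \<in> A \<times> B. ?d p = Z}"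
        then obtain X Y where XY: "W = sym_diff X X0" "X \<in> A" "Y \<in> B" "sym_diff X Y = Z" by auto
        have "sym_diff X Y = sym_diff X0 Y0" using XY X0 by simp
        then have "W = sym_diff Y Y0" unfolding XY(1) by blast
        then show "W \<in> A \<inter> B" using XY X0 A[of X X0] B[of Y Y0] by simp
      qed
      show "finite (A \<inter> B)" using fin by simp
    qed
  next
    case True
    then show ?thesis by (simp only: card.empty)
  qed
  have "card A * card B = (\<Sum>p\<in>A \<times> B. 1)" by (simp add: card_cartesian_product)
  also have "\<dots> = (\<Sum>Z\<in>C. \<Sum>p | p \<in> A \<times> B \<and> ?d p = Z. 1)"
  proof (rule sum.group[symmetric])
    have "sym_diff X Y \<in> C" if "X \<in> A" "Y \<in> B" for X Y
      using C[of X Y] assms(2,3) that by blast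
    then show "?d ` (A \<times> B) \<subseteq> C" by auto
  qed (use fin assms(1) in simp_all)
  also have "\<dots> = (\<Sum>Z\<in>C. card {p \<in> A \<times> B. ?d p = Z})" by simp
  also have "\<dots> \<le> (\<Sum>Z\<in>C. card (A \<inter> B))" by (intro sum_mono fiber)
  finally show ?thesis by simp
qed

section \<open>Unions of blocks and components of the coset graph\<close>

text \<open>Blocks other than \<open>B\<close> are disjoint from \<open>B\<close> and meet
  \<open>Y\<close> only inside \<open>V\<close>, so adding the block \<open>B\<close> adds one
  independent condition.\<close>

lemma saturated_restrict:
  assumes B: "B \<in> \<pi>" "B \<inter> V = {}" "\<And>C. C \<in> \<pi> \<Longrightarrow> C \<noteq> B \<Longrightarrow> C \<inter> B = {}"
    and Y: "Y \<subseteq> V \<union> B"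
  shows "(\<forall>C\<in>\<pi>. C \<subseteq> Y \<or> C \<inter> Y = {}) \<longleftrightarrow>
    (\<forall>C\<in>\<pi>. C \<subseteq> Y \<inter> V \<or> C \<inter> (Y \<inter> V) = {}) \<and> (B \<subseteq> Y \<or> B \<inter> Y = {})"
proof -
  define P where "P C \<longleftrightarrow> C \<subseteq> Y \<or> C \<inter> Y = {}" for C
  define Q where "Q C \<longleftrightarrow> C \<subseteq> Y \<inter> V \<or> C \<inter> (Y \<inter> V) = {}" for C
  have "P C \<longleftrightarrow> Q C" if "C \<in> \<pi>" "C \<noteq> B" for C
    unfolding P_def Q_def using B(3)[OF that] Y by blast
  moreover have "Q B" unfolding Q_def using B(2) by blast
  ultimately have "(\<forall>C\<in>\<pi>. P C) \<longleftrightarrow> (\<forall>C\<in>\<pi>. Q C) \<and> P B" using B(1) by metis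
  then show ?thesis unfolding P_def Q_def .
qed

text \<open>The sets saturated for \<open>\<pi>\<close>, a group under symmetric difference. A block
  sticking out of \<open>{1..k * n}\<close> must be missed entirely.\<close>

definition block_unions :: "nat \<Rightarrow> nat \<Rightarrow> nat set set \<Rightarrow> nat set set" where
  "block_unions k n \<pi> = {Y. Y \<subseteq> {1..k * n} \<and> (\<forall>B\<in>\<pi>. B \<subseteq> Y \<or> B \<inter> Y = {})}"

lemma finite_block_unions: "finite (block_unions k n \<pi>)"
  by (rule finite_subset[of _ "Pow {1..k * n}"]) (auto simp: block_unions_def)

lemma block_unions_sym_diff:
  assumes "X \<in> block_unions k n \<pi>" "Y \<in> block_unions k n \<pi>"
  shows "sym_diff X Y \<in> block_unions k n \<pi>"
proof -
  have "B \<subseteq> sym_diff X Y \<or> B \<inter> sym_diff X Y = {}" if "B \<in> \<pi>" for B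
  proof -
    have "B \<subseteq> X \<or> B \<inter> X = {}" "B \<subseteq> Y \<or> B \<inter> Y = {}"
      using assms that by (auto simp: block_unions_def)
    then show ?thesis by blast
  qed
  then show ?thesis using assms by (auto simp: block_unions_def)
qed

lemma block_unions_image:
  assumes h: "h \<in> sym_fin (k * n)"
  shows "block_unions k n ((`) h ` \<pi>) = (`) h ` block_unions k n \<pi>"
proof -
  have inj: "inj h" using h sym_fin_in_sym_inf sym_inf_inj by blast
  have mem: "h ` Y \<in> block_unions k n ((`) h ` \<pi>) \<longleftrightarrow> Y \<in> block_unions k n \<pi>" for Y
  proof -
    have "h ` Y \<subseteq> {1..k * n} \<longleftrightarrow> Y \<subseteq> {1..k * n}"
      using inj_image_subset_iff[OF inj, of Y "{1..k * n}"] sym_fin_image[OF h] by simp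
    then show ?thesis
      using inj by (simp add: block_unions_def inj_image_subset_iff image_Int[symmetric])
  qed
  show ?thesis
  proof (intro equalityI subsetI)
    fix Z assume Z: "Z \<in> block_unions k n ((`) h ` \<pi>)"
    have "Z = h ` (inv h ` Z)"
      using sym_inf_bij[OF sym_fin_in_sym_inf[OF h]] by (metis bij_is_surj image_f_inv_f)
    then show "Z \<in> (`) h ` block_unions k n \<pi>" using mem Z by (metis imageI)
  qed (use mem in auto)
qed

abbreviation joint_unions :: "nat \<Rightarrow> nat \<Rightarrow> (nat \<Rightarrow> nat) \<Rightarrow> nat set set" where
  "joint_unions k n x \<equiv>
    block_unions k n (block_images k id) \<inter> block_unions k n (block_images k x)"

context
  fixes k :: nat
  assumes k: "1 \<le> k"
begin

text \<open>\<open>x\<close> fixes the new block pointwise, so it is a block of both partitions, and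
  a joint union may freely contain or miss it.\<close>

lemma joint_unions_Suc:
  assumes x: "x \<in> sym_fin (k * n)"
  shows "card (joint_unions k (Suc n) x) = 2 * card (joint_unions k n x)"
proof -
  let ?B = "block k (Suc n)" and ?J = "joint_unions k n x"
  have xs: "x \<in> sym_inf" using x by (rule sym_fin_in_sym_inf)
  have disj: "?B \<inter> {1..k * n} = {}" by (auto simp: block_def)
  have union: "{1..k * Suc n} = {1..k * n} \<union> ?B" by (auto simp: block_def)
  have "x ` ?B = ?B"
    using sym_fin_fix[OF x] by (intro trans[OF image_cong image_ident]) (auto simp: block_def)
  then have "?B = y ` ?B" if "y = id \<or> y = x" for y
    using that by auto
  then have mem: "?B \<in> block_images k y" if "y = id \<or> y = x" for y
    unfolding block_images_def using that by (intro image_eqI[of _ _ "Suc n"]) auto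
  have other: "C \<inter> ?B = {}" if "y = id \<or> y = x" "C \<in> block_images k y" "C \<noteq> ?B" for y C
  proof -
    have "y \<in> sym_inf" using that(1) xs by auto
    then show ?thesis using block_images_disjoint[OF k _ that(2) mem[OF that(1)]] that(3) by metis
  qed
  have iff: "Y \<in> block_unions k (Suc n) (block_images k y) \<longleftrightarrow>
      Y \<inter> {1..k * n} \<in> block_unions k n (block_images k y) \<and> (?B \<subseteq> Y \<or> ?B \<inter> Y = {}) \<and>
      Y \<subseteq> {1..k * n} \<union> ?B" if y: "y = id \<or> y = x" for Y y
  proof (cases "Y \<subseteq> {1..k * n} \<union> ?B")
    case True
    note saturated_restrict[OF mem[OF y] disj other[OF y] True]
    then show ?thesis
      unfolding block_unions_def union mem_Collect_eq using True
      by (simp only: Int_lower2 simp_thms conj_assoc)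
  qed (simp only: block_unions_def union mem_Collect_eq simp_thms)
  have eq: "joint_unions k (Suc n) x = ?J \<union> (\<lambda>Y. Y \<union> ?B) ` ?J"
  proof (intro equalityI subsetI)
    fix Y assume Y: "Y \<in> joint_unions k (Suc n) x"
    then have J: "Y \<inter> {1..k * n} \<in> ?J" and B: "?B \<subseteq> Y \<or> ?B \<inter> Y = {}" "Y \<subseteq> {1..k * n} \<union> ?B"
      using iff by blast+
    from B(1) show "Y \<in> ?J \<union> (\<lambda>Y. Y \<union> ?B) ` ?J"
    proof
      assume "?B \<subseteq> Y"
      then have "Y = Y \<inter> {1..k * n} \<union> ?B" using B(2) by blast
      then show ?thesis using J by blast
    next
      assume "?B \<inter> Y = {}"
      then have "Y = Y \<inter> {1..k * n}" using B(2) by blast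
      then show ?thesis using J by auto
    qed
  next
    fix Y assume "Y \<in> ?J \<union> (\<lambda>Y. Y \<union> ?B) ` ?J"
    then obtain Z where Z: "Z \<in> ?J" "Y = Z \<or> Y = Z \<union> ?B" by blast
    then have "Z \<subseteq> {1..k * n}" by (simp add: block_unions_def)
    then have "Y \<inter> {1..k * n} = Z" "?B \<subseteq> Y \<or> ?B \<inter> Y = {}" "Y \<subseteq> {1..k * n} \<union> ?B"
      using Z disj by blast+
    then show "Y \<in> joint_unions k (Suc n) x" using iff Z(1) by blast
  qed
  have sub: "Y \<inter> ?B = {}" if "Y \<in> ?J" for Y
    using that disj by (auto simp: block_unions_def)
  have "?B \<noteq> {}" using block_nonempty[OF k] by simp
  then have "?J \<inter> (\<lambda>Y. Y \<union> ?B) ` ?J = {}" using sub by blast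
  moreover have "inj_on (\<lambda>Y. Y \<union> ?B) ?J" by (rule inj_onI) (use sub in blast)
  ultimately show ?thesis
    unfolding eq by (subst card_Un_disjoint) (auto simp: finite_block_unions card_image)
qed

lemma joint_unions_mono:
  assumes "x \<in> sym_fin (k * n)" "n \<le> n'"
  shows "card (joint_unions k n' x) = 2 ^ (n' - n) * card (joint_unions k n x)"
  using assms(2)
proof (induction n' rule: dec_induct)
  case (step m)
  have "x \<in> sym_fin (k * m)" using assms(1) step(1) sym_fin_mono mult_le_mono2 by blast
  then show ?case by (simp only: joint_unions_Suc step.IH Suc_diff_le[OF step.hyps(1)] power_Suc mult.assoc)
qed simp

text \<open>Translation by \<open>h\<close> preserves the standard partition and maps that of
  \<open>x\<close> to that of \<open>h \<circ> x\<close>; the right factor does not affect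
  partitions.\<close>

lemma joint_unions_hyp:
  assumes h: "h \<in> hyp_inf k" "h \<in> sym_fin (k * n)" and h': "h' \<in> hyp_inf k"
  shows "card (joint_unions k n (h \<circ> x \<circ> h')) = card (joint_unions k n x)"
proof -
  have inj: "inj ((`) h)" by (rule inj_image_sym[OF hyp_inf_sym[OF k h(1)]])
  have "block_images k id = (`) h ` block_images k id"
    using h(1) block_images_comp[of k h id] by (simp add: hyp_inf_iff[OF k])
  then have 1: "block_unions k n (block_images k id) = (`) h ` block_unions k n (block_images k id)"
    using block_unions_image[OF h(2)] by metis
  have 2: "block_unions k n (block_images k (h \<circ> x \<circ> h')) =
      (`) h ` block_unions k n (block_images k x)"
    unfolding block_images_comp_hyp[OF k h'] block_images_comp[of k h x]
    by (rule block_unions_image[OF h(2)])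
  have "joint_unions k n (h \<circ> x \<circ> h') = (`) h ` joint_unions k n x"
    unfolding 2 image_Int[OF inj] using 1 by simp
  then show ?thesis using inj by (simp add: card_image inj_on_subset)
qed

text \<open>Vertex \<open>i\<close> stands for the image of \<open>block k i\<close> under
  \<open>x\<close>, and an edge joins two such images meeting a common standard block. So the vertex
  sets closed under adjacency correspond to the joint unions, and \<open>card_components\<close>
  counts them.\<close>

lemma card_joint_unions:
  assumes x: "x \<in> sym_fin (k * n)"
  shows "card (joint_unions k n x) = 2 ^ card (components (coset_graph k n x))"
proof -
  let ?G = "coset_graph k n x"
  have xs: "x \<in> sym_inf" using x by (rule sym_fin_in_sym_inf)
  have bij: "bij x" by (rule sym_inf_bij[OF xs])
  \<comment> \<open>\<open>?p r\<close> is the index of the block whose image under \<open>x\<close>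
    contains \<open>r\<close>, as \<open>xblock\<close> confirms.\<close>
  let ?p = "\<lambda>r. block_index k (inv x r)"
  have p: "?p r \<in> {1..n}" if "r \<in> {1..k * n}" for r
  proof -
    have "inv x r \<in> {1..k * n}"
      using permutes_in_image[of "inv x" "{1..k * n}" r] sym_fin_inv[OF x] that
      by (simp add: sym_fin_def)
    then show ?thesis using block_index_ge_1[OF k] block_index_le_iff[OF k] by simp
  qed
  have bsub: "block k u \<subseteq> {1..k * n}" if "u \<in> {1..n}" for u
    using that by (intro block_subset_iff[OF k, THEN iffD2]) auto
  have adj: "(v, w) \<in> adjacency ?G \<longleftrightarrow>
      (\<exists>u\<in>{1..n}. \<exists>r\<in>block k u. \<exists>s\<in>block k u. r \<noteq> s \<and> v = ?p r \<and> w = ?p s)" for v w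
  proof
    assume "(v, w) \<in> adjacency ?G"
    then obtain e u where e: "u \<in> {1..n}" "e \<subseteq> block k u" "card e = 2" "?p ` e = {v, w}"
      by (auto simp: adjacency_def coset_graph_def)
    obtain r s where rs: "e = {r, s}" "r \<noteq> s" using e(3) by (auto simp: card_2_iff)
    then have "v = ?p r \<and> w = ?p s \<or> v = ?p s \<and> w = ?p r"
      using e(4) by (simp add: doubleton_eq_iff) blast
    moreover have "r \<in> block k u" "s \<in> block k u" using e(2) rs(1) by auto
    ultimately show "\<exists>u\<in>{1..n}. \<exists>r\<in>block k u. \<exists>s\<in>block k u. r \<noteq> s \<and> v = ?p r \<and> w = ?p s"
      using e(1) rs(2) by metis
  next
    assume "\<exists>u\<in>{1..n}. \<exists>r\<in>block k u. \<exists>s\<in>block k u. r \<noteq> s \<and> v = ?p r \<and> w = ?p s"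
    then obtain u r s where "u \<in> {1..n}" "r \<in> block k u" "s \<in> block k u" "r \<noteq> s"
      "v = ?p r" "w = ?p s" by blast
    then show "(v, w) \<in> adjacency ?G"
      unfolding adjacency_def coset_graph_def
      by (auto intro!: exI[of _ "{r, s}"] bexI[of _ u])
  qed
  have adj_sub: "adjacency ?G \<subseteq> verts ?G \<times> verts ?G"
  proof (rule subrelI)
    fix v w assume "(v, w) \<in> adjacency ?G"
    then obtain u r s where "u \<in> {1..n}" "r \<in> block k u" "s \<in> block k u" "v = ?p r" "w = ?p s"
      unfolding adj by blast
    then have "v \<in> {1..n}" "w \<in> {1..n}" using p bsub subsetD by metis+
    then show "(v, w) \<in> verts ?G \<times> verts ?G" by (simp add: coset_graph_def)
  qed
  let ?S = "{X. X \<subseteq> verts ?G \<and> (\<forall>(v, w)\<in>adjacency ?G. v \<in> X \<longleftrightarrow> w \<in> X)}"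
  let ?f = "\<lambda>X. {r \<in> {1..k * n}. ?p r \<in> X}"
  let ?f' = "\<lambda>Y. {i \<in> {1..n}. x ` block k i \<subseteq> Y}"
  \<comment> \<open>For \<open>r = s\<close> the equivalence is trivial, so closure under the
    two-element edges amounts to constancy on whole standard blocks.\<close>
  have S: "X \<in> ?S \<longleftrightarrow> X \<subseteq> {1..n} \<and>
      (\<forall>u\<in>{1..n}. \<forall>r\<in>block k u. \<forall>s\<in>block k u. ?p r \<in> X \<longleftrightarrow> ?p s \<in> X)" for X
  proof -
    have "verts ?G = {1..n}" by (simp add: coset_graph_def)
    moreover have "(\<forall>(v, w)\<in>adjacency ?G. v \<in> X \<longleftrightarrow> w \<in> X) \<longleftrightarrow>
       (\<forall>u\<in>{1..n}. \<forall>r\<in>block k u. \<forall>s\<in>block k u. ?p r \<in> X \<longleftrightarrow> ?p s \<in> X)"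
    proof
      assume X: "\<forall>(v, w)\<in>adjacency ?G. v \<in> X \<longleftrightarrow> w \<in> X"
      have "?p r \<in> X \<longleftrightarrow> ?p s \<in> X" if "u \<in> {1..n}" "r \<in> block k u" "s \<in> block k u" for u r s
      proof (cases "r = s")
        case False
        then have "(?p r, ?p s) \<in> adjacency ?G" using adj that by metis
        then show ?thesis using X by auto
      qed simp
      then show "\<forall>u\<in>{1..n}. \<forall>r\<in>block k u. \<forall>s\<in>block k u. ?p r \<in> X \<longleftrightarrow> ?p s \<in> X" by metis
    next
      assume X: "\<forall>u\<in>{1..n}. \<forall>r\<in>block k u. \<forall>s\<in>block k u. ?p r \<in> X \<longleftrightarrow> ?p s \<in> X"
      then have "v \<in> X \<longleftrightarrow> w \<in> X" if "(v, w) \<in> adjacency ?G" for v w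
        using adj[of v w] that by auto
      then show "\<forall>(v, w)\<in>adjacency ?G. v \<in> X \<longleftrightarrow> w \<in> X" by blast
    qed
    ultimately show ?thesis by (simp only: mem_Collect_eq)
  qed
  have px: "?p (x r) = block_index k r" for r using bij by (simp add: bij_is_inj)
  have xblock: "r \<in> x ` block k (?p r)" if "1 \<le> r" for r
  proof -
    have "1 \<le> inv x r" using sym_inf_ge_1[OF sym_inf_inv[OF xs]] that by simp
    then have "inv x r \<in> block k (?p r)" by (rule block_index_mem[OF k])
    moreover have "r = x (inv x r)" using bij by (simp add: bij_is_surj surj_f_inv_f)
    ultimately show ?thesis by blast
  qed
  have xsub: "x ` block k i \<subseteq> {1..k * n}" if "i \<in> {1..n}" for i
    using bsub[OF that] sym_fin_image[OF x] by blast
  have "bij_betw ?f ?S (joint_unions k n x)"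
  proof (rule bij_betw_byWitness[where f' = ?f'])
    show "\<forall>X\<in>?S. ?f' (?f X) = X"
    proof
      fix X assume "X \<in> ?S"
      then have X: "X \<subseteq> {1..n}" by (rule S[THEN iffD1, THEN conjunct1])
      have "x ` block k i \<subseteq> ?f X \<longleftrightarrow> i \<in> X" if i: "i \<in> {1..n}" for i
      proof -
        have "?p r = i" if "r \<in> x ` block k i" for r
          using that i px block_index_eq[OF k] by auto
        moreover obtain r where "r \<in> x ` block k i" using block_nonempty[OF k, of i] i by auto
        ultimately show ?thesis using xsub[OF i] by blast
      qed
      then show "?f' (?f X) = X" using X by blast
    qed
    show "\<forall>Y\<in>joint_unions k n x. ?f (?f' Y) = Y"
    proof
      fix Y assume "Y \<in> joint_unions k n x"
      then have Y: "Y \<subseteq> {1..k * n}" "\<And>i. 1 \<le> i \<Longrightarrow> x ` block k i \<subseteq> Y \<or> x ` block k i \<inter> Y = {}"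
        by (auto simp: block_unions_def block_images_def)
      have "?p r \<in> ?f' Y \<longleftrightarrow> r \<in> Y" if r: "r \<in> {1..k * n}" for r
        using p[OF r] xblock[of r] Y(2)[of "?p r"] r by auto
      then show "?f (?f' Y) = Y" using Y(1) by blast
    qed
    show "?f ` ?S \<subseteq> joint_unions k n x"
    proof
      fix Y assume "Y \<in> ?f ` ?S"
      then obtain X where X: "X \<in> ?S" "Y = ?f X" by blast
      have memY: "r \<in> Y \<longleftrightarrow> r \<in> {1..k * n} \<and> ?p r \<in> X" for r unfolding X(2) by (rule mem_Collect_eq)
      have "block k u \<subseteq> Y \<or> block k u \<inter> Y = {}" if "1 \<le> u" for u
      proof (cases "u \<le> n")
        case True
        then have u: "u \<in> {1..n}" using that by simp
        have same: "?p r \<in> X \<longleftrightarrow> ?p s \<in> X" if "r \<in> block k u" "s \<in> block k u" for r s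
          using S[THEN iffD1, OF X(1), THEN conjunct2] u that by metis
        show ?thesis
        proof (cases "\<exists>r\<in>block k u. ?p r \<in> X")
          case True
          then have "?p s \<in> X" if "s \<in> block k u" for s using same that by metis
          then have "block k u \<subseteq> Y" using bsub[OF u] memY by blast
          then show ?thesis ..
        next
          case False
          then have "block k u \<inter> Y = {}" using memY by blast
          then show ?thesis ..
        qed
      next
        case False
        then have "block k u \<inter> {1..k * n} = {}" using block_beyond[OF k, of n u] by fastforce
        then show ?thesis using memY by blast
      qed
      moreover have "x ` block k i \<subseteq> Y \<or> x ` block k i \<inter> Y = {}" if i: "1 \<le> i" for i
      proof -
        have pi: "?p r = i" if "r \<in> x ` block k i" for r
          using that i px block_index_eq[OF k] by auto
        show ?thesis
        proof (cases "i \<in> X")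
          case True
          then have "i \<in> {1..n}" using S[THEN iffD1, OF X(1), THEN conjunct1] by (rule subsetD[rotated])
          from xsub[OF this] have "x ` block k i \<subseteq> Y" using pi True memY by blast
          then show ?thesis ..
        next
          case False
          then have "x ` block k i \<inter> Y = {}" using pi memY by blast
          then show ?thesis ..
        qed
      qed
      moreover have "Y \<subseteq> {1..k * n}" using memY by blast
      ultimately show "Y \<in> joint_unions k n x"
        by (auto simp: block_unions_def block_images_def)
    qed
    show "?f' ` joint_unions k n x \<subseteq> ?S"
    proof
      fix X assume "X \<in> ?f' ` joint_unions k n x"
      then obtain Y where Y: "Y \<in> joint_unions k n x" "X = ?f' Y" by blast
      have iff: "?p r \<in> X \<longleftrightarrow> r \<in> Y" if r: "r \<in> {1..k * n}" for r
      proof -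
        have "x ` block k (?p r) \<subseteq> Y \<or> x ` block k (?p r) \<inter> Y = {}"
          using Y(1) p[OF r] by (auto simp: block_unions_def block_images_def)
        then show ?thesis using p[OF r] xblock[of r] r unfolding Y(2) by auto
      qed
      have "?p r \<in> X \<longleftrightarrow> ?p s \<in> X" if "u \<in> {1..n}" "r \<in> block k u" "s \<in> block k u" for u r s
      proof -
        have "block k u \<subseteq> Y \<or> block k u \<inter> Y = {}"
          using Y(1) that(1) by (auto simp: block_unions_def block_images_def)
        moreover have "r \<in> {1..k * n}" "s \<in> {1..k * n}" using bsub that subsetD by metis+
        ultimately show ?thesis using that(2,3) iff by blast
      qed
      moreover have "X \<subseteq> {1..n}" unfolding Y(2) by blast
      ultimately show "X \<in> ?S" by (intro S[THEN iffD2] conjI ballI)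
    qed
  qed
  then have "card (joint_unions k n x) = card ?S" by (rule bij_betw_same_card[symmetric])
  also have "\<dots> = 2 ^ card (components ?G)"
    using adj_sub by (intro card_components) (simp_all add: coset_graph_def)
  finally show ?thesis .
qed

section \<open>Weights of double cosets and the case of additive weights\<close>

text \<open>Each further index adds one vertex and doubles the number of joint unions, hence adds
  one component.\<close>

lemma coset_graph_weight_mono:
  assumes "x \<in> sym_fin (k * n)" "n \<le> n'"
  shows "graph_weight (coset_graph k n' x) = graph_weight (coset_graph k n x)"
proof -
  have x': "x \<in> sym_fin (k * n')" using assms sym_fin_mono mult_le_mono2 by blast
  have "(2::nat) ^ card (components (coset_graph k n' x)) =
      2 ^ ((n' - n) + card (components (coset_graph k n x)))"
    using joint_unions_mono[OF assms]
    by (simp only: card_joint_unions[OF assms(1)] card_joint_unions[OF x'] power_add)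
  then have "card (components (coset_graph k n' x)) =
      (n' - n) + card (components (coset_graph k n x))"
    by (rule power_inject_exp[THEN iffD1, rotated]) simp
  then show ?thesis using assms(2) by (simp add: graph_weight_def coset_graph_def)
qed

text \<open>Two elements of \<open>M\<close> are compared at an index \<open>b\<close> large enough
  for both and for the left multiplier \<open>h\<close>; there \<open>joint_unions_hyp\<close>
  equates their component numbers.\<close>

lemma dc_weight_eq:
  assumes M: "M \<in> double_cosets k" and g: "g \<in> dc_part k M n"
  shows "dc_weight k M = graph_weight (coset_graph k n g)"
proof -
  have eq: "graph_weight (coset_graph k n' g') = graph_weight (coset_graph k n g)"
    if g': "g' \<in> dc_part k M n'" for n' g'
  proof -
    have gM: "g \<in> M" "g' \<in> M" using g g' by (auto simp: dc_part_def)
    obtain h h' where h: "h \<in> hyp_inf k" "h' \<in> hyp_inf k" "g' = h \<circ> g \<circ> h'"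
      using double_coset_obtains[OF k M gM] .
    obtain m where m: "\<And>n'. m \<le> n' \<Longrightarrow> h \<in> sym_fin (k * n')"
      using sym_inf_mono_obtains[OF k hyp_inf_sym[OF k h(1)]] by blast
    define b where "b = Max {m, n, n'}"
    have b: "m \<le> b" "n \<le> b" "n' \<le> b" by (simp_all add: b_def)
    have gn: "g \<in> sym_fin (k * n)" "g' \<in> sym_fin (k * n')" using g g' by (auto simp: dc_part_def)
    then have gb: "g \<in> sym_fin (k * b)" "g' \<in> sym_fin (k * b)"
      using b sym_fin_mono mult_le_mono2 by blast+
    have "(2::nat) ^ card (components (coset_graph k b g')) = 2 ^ card (components (coset_graph k b g))"
      using joint_unions_hyp[OF h(1) m[OF b(1)] h(2), of g, folded h(3)]
      by (simp only: card_joint_unions[OF gb(1)] card_joint_unions[OF gb(2)])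
    then have "card (components (coset_graph k b g')) = card (components (coset_graph k b g))"
      by (rule power_inject_exp[THEN iffD1, rotated]) simp
    then have "graph_weight (coset_graph k b g') = graph_weight (coset_graph k b g)"
      by (simp add: graph_weight_def coset_graph_def)
    then show ?thesis
      using coset_graph_weight_mono[OF gn(1) b(2)] coset_graph_weight_mono[OF gn(2) b(3)] by simp
  qed
  show ?thesis unfolding dc_weight_def
  proof (rule the_equality)
    show "\<forall>n'. \<forall>g'\<in>dc_part k M n'. graph_weight (coset_graph k n' g') = graph_weight (coset_graph k n g)"
      using eq by blast
  next
    fix w assume "\<forall>n. \<forall>g\<in>dc_part k M n. graph_weight (coset_graph k n g) = w"
    then show "w = graph_weight (coset_graph k n g)" using g by metis
  qed
qed

lemma card_components_coset_graph_le: "card (components (coset_graph k n x)) \<le> n"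
proof -
  let ?G = "coset_graph k n x"
  have "components ?G = (\<lambda>v. {(v, w) \<in> verts ?G \<times> verts ?G. (v, w) \<in> (adjacency ?G)\<^sup>*} `` {v}) ` {1..n}"
    by (auto simp: components_def quotient_def coset_graph_def)
  then have "card (components ?G) \<le> card {1..n}"
    by (simp only: card_image_le finite_atLeastAtMost)
  then show ?thesis by simp
qed

text \<open>Additivity of the weights leaves no slack in \<open>card_Int_sym_diff_closed\<close>, so
  a block beyond \<open>m\<close>, being a block of both \<Gamma> and \<open>g \<Gamma>\<close>, is
  also saturated for \<open>\<pi>\<close>.\<close>

lemma block_support_coset_factors:
  assumes M: "M \<in> double_cosets k" and N: "N \<in> double_cosets k" and L: "L \<in> double_cosets k"
    and weight: "dc_weight k L = dc_weight k M + dc_weight k N"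
    and g: "g \<in> dc_part k L m" and \<pi>: "\<pi> \<in> coset_factors k M N g"
  shows "block_support k \<pi> \<subseteq> {1..m}"
proof
  fix i assume i: "i \<in> block_support k \<pi>"
  then have i1: "1 \<le> i" by (simp add: block_support_def)
  show "i \<in> {1..m}"
  proof (rule ccontr)
    assume "i \<notin> {1..m}"
    then have im: "m < i" using i1 by simp
    obtain x y where xy: "\<pi> = block_images k x" "x \<in> M" "y \<in> N" "x \<circ> y = g"
      using \<pi> by (auto simp: coset_factors_def)
    have xs: "x \<in> sym_inf" and ys: "y \<in> sym_inf"
      using double_coset_sym[OF k M xy(2)] double_coset_sym[OF k N xy(3)] by auto
    obtain a where a: "\<And>n'. a \<le> n' \<Longrightarrow> x \<in> sym_fin (k * n')"
      using sym_inf_mono_obtains[OF k xs] by blast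
    obtain b where b: "\<And>n'. b \<le> n' \<Longrightarrow> y \<in> sym_fin (k * n')"
      using sym_inf_mono_obtains[OF k ys] by blast
    \<comment> \<open>Large enough for \<open>x\<close>, \<open>y\<close> and
      \<open>block k i\<close>; the factors may reach beyond \<open>m\<close> although their product
      does not.\<close>
    define n where "n = Max {a, b, i}"
    have n: "a \<le> n" "b \<le> n" "i \<le> n" by (simp_all add: n_def)
    have xn: "x \<in> sym_fin (k * n)" and yn: "y \<in> sym_fin (k * n)" using a b n by auto
    have gm: "g \<in> L" "g \<in> sym_fin (k * m)" using g by (auto simp: dc_part_def)
    have gn: "g \<in> sym_fin (k * n)" using sym_fin_comp[OF xn yn] xy(4) by simp
    have gs: "g \<in> sym_inf" using gn by (rule sym_fin_in_sym_inf)
    let ?c = "\<lambda>x. card (components (coset_graph k n x))"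
    let ?F = "\<lambda>x. block_unions k n (block_images k x)"
    have "dc_weight k M = int n - int (?c x)" "dc_weight k N = int n - int (?c y)"
      "dc_weight k L = int n - int (?c g)"
      using dc_weight_eq[OF M, of x n] dc_weight_eq[OF N, of y n] dc_weight_eq[OF L, of g n]
        xy xn yn gm(1) gn by (simp_all add: dc_part_def graph_weight_def coset_graph_def)
    then have c: "n + ?c g = ?c x + ?c y" using weight by linarith
    have img: "?F (x \<circ> z) = (`) x ` ?F z" for z
      unfolding block_images_comp by (rule block_unions_image[OF xn])
    have inj: "inj ((`) x)" by (rule inj_image_sym[OF xs])
    \<comment> \<open>Translation by \<open>x\<close> reduces this to the identity, whose joint
      unions are all its block unions.\<close>
    have Fx: "card (?F x) \<le> 2 ^ n"
    proof -
      have "card (?F x) = card (?F id)"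
        using img[of id] inj by (simp add: card_image inj_on_subset)
      also have "\<dots> = 2 ^ ?c id" using card_joint_unions[of id n] by simp
      also have "\<dots> \<le> 2 ^ n" using card_components_coset_graph_le by (intro power_increasing) auto
      finally show ?thesis .
    qed
    \<comment> \<open>Since \<open>g = x \<circ> y\<close>, translation by \<open>x\<close> carries
      the joint unions of \<open>y\<close> to this intersection.\<close>
    have "?F x \<inter> ?F g = (`) x ` (?F id \<inter> ?F y)"
      using img[of id] img[of y] xy(4) by (simp add: image_Int[OF inj])
    then have Fxg: "card (?F x \<inter> ?F g) = 2 ^ ?c y"
      using inj card_joint_unions[OF yn] by (simp add: card_image inj_on_subset)
    have "card (?F id \<inter> ?F x) * card (?F x \<inter> ?F g) \<le>
        card (?F x) * card ((?F id \<inter> ?F x) \<inter> (?F x \<inter> ?F g))"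
      by (rule card_Int_sym_diff_closed) (auto simp: finite_block_unions intro!: block_unions_sym_diff)
    also have "\<dots> \<le> 2 ^ n * card ((?F id \<inter> ?F x) \<inter> (?F x \<inter> ?F g))"
      using Fx by (rule mult_le_mono1)
    \<comment> \<open>The left side uses \<open>c\<close> to rewrite the exponent
      \<open>?c x + ?c y\<close>. Cancelling \<open>2 ^ n\<close> makes the triple intersection as
      large as \<open>?F id \<inter> ?F g\<close>, which contains it.\<close>
    finally have "2 ^ n * 2 ^ ?c g \<le> 2 ^ n * card ((?F id \<inter> ?F x) \<inter> (?F x \<inter> ?F g))"
      using c by (simp only: Fxg card_joint_unions[OF xn] power_add[symmetric])
    then have "card (?F id \<inter> ?F g) \<le> card ((?F id \<inter> ?F x) \<inter> (?F x \<inter> ?F g))"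
      by (simp add: card_joint_unions[OF gn])
    then have "(?F id \<inter> ?F x) \<inter> (?F x \<inter> ?F g) = ?F id \<inter> ?F g"
      by (intro card_seteq) (auto simp: finite_block_unions)
    then have sub: "?F id \<inter> ?F g \<subseteq> ?F x" by blast
    let ?B = "block k i"
    have "?B \<in> block_images k g"
    proof -
      have "i \<notin> block_support k (block_images k g)"
        using block_support_sym_fin[OF k gm(2)] im by auto
      then show ?thesis using i1 by (simp add: block_support_def)
    qed
    moreover have "?B \<in> block_images k id" using i1 by (simp add: block_images_id[OF k])
    moreover have "?B \<subseteq> {1..k * n}" using block_subset_iff[OF k i1] n(3) by simp
    ultimately have "?B \<in> ?F id \<inter> ?F g"
      using block_images_disjoint[OF k gs] block_images_disjoint[OF k sym_inf_id]
      unfolding block_unions_def by blast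
    \<comment> \<open>A block of \<open>x\<close> through a point of \<open>?B\<close> now lies
      inside \<open>?B\<close> and has the same size, so \<open>?B\<close> is a block of
      \<open>\<pi>\<close>, against the choice of \<open>i\<close>.\<close>
    then have BF: "?B \<in> ?F x" using sub by blast
    obtain r where r: "r \<in> ?B" using block_nonempty[OF k i1] by blast
    obtain B where B: "B \<in> block_images k x" "r \<in> B"
      using block_images_cover[OF k xs block_ge_1[OF r]] .
    then have "B \<subseteq> ?B" using BF r by (auto simp: block_unions_def)
    then have "B = ?B"
      using block_images_card[OF k xs B(1)] card_block[OF i1] by (simp add: card_subset_eq)
    then show False using B(1) i xy(1) by (simp add: block_support_def)
  qed
qed

end

section \<open>Polynomiality and constancy of the structure coefficients\<close>

theorem theorem1p1:
  fixes k :: nat and M N L :: "(nat \<Rightarrow> nat) set"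
  assumes "k \<ge> 2"
    and "M \<in> double_cosets k" and "N \<in> double_cosets k" and "L \<in> double_cosets k"
  shows "(\<exists>P :: complex poly. \<forall>n\<ge>1.
            dc_part k M n \<noteq> {} \<and> dc_part k N n \<noteq> {} \<and> dc_part k L n \<noteq> {} \<longrightarrow>
              struct_coeff k M N L n = poly P (of_nat n)) \<and>
         (dc_weight k L = dc_weight k M + dc_weight k N \<longrightarrow>
           (\<exists>C. \<forall>n\<ge>1.
            dc_part k M n \<noteq> {} \<and> dc_part k N n \<noteq> {} \<and> dc_part k L n \<noteq> {} \<longrightarrow>
              struct_coeff k M N L n = C))"
proof (cases "\<exists>n. dc_part k L n \<noteq> {}")
  case False
  then show ?thesis by auto
next
  case True
  have k: "1 \<le> k" using assms(1) by simp
  \<comment> \<open>The least index yields one \<open>g\<close> that represents \<open>L\<close> at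
    every relevant \<open>n\<close>, so a single polynomial, valid from \<open>m\<close> on, serves
    all of them.\<close>
  define m where "m = (LEAST n. dc_part k L n \<noteq> {})"
  obtain g where g: "g \<in> dc_part k L m"
    using LeastI_ex[OF True] unfolding m_def by blast
  have gm: "g \<in> L" "g \<in> sym_fin (k * m)" using g by (auto simp: dc_part_def)
  have coeff: "m \<le> n \<and> struct_coeff k M N L n = of_nat (card (coset_factors_at k M N g n))"
    if "dc_part k L n \<noteq> {}" for n
  proof -
    have mn: "m \<le> n" unfolding m_def using that by (rule Least_le)
    then have "g \<in> dc_part k L n"
      using gm sym_fin_mono[of "k * m" "k * n"] by (auto simp: dc_part_def)
    then show ?thesis using struct_coeff_eq[OF k assms(2,3,4)] mn by blast
  qed
  obtain P where P: "\<And>n. m \<le> n \<Longrightarrow>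
      of_nat (card (coset_factors_at k M N g n)) = poly P (of_nat n :: complex)"
    using card_coset_factors_at_poly[OF k assms(2,3) gm(2)] by blast
  show ?thesis
  proof (intro conjI impI)
    show "\<exists>P :: complex poly. \<forall>n\<ge>1.
        dc_part k M n \<noteq> {} \<and> dc_part k N n \<noteq> {} \<and> dc_part k L n \<noteq> {} \<longrightarrow>
          struct_coeff k M N L n = poly P (of_nat n)"
      using coeff P by (intro exI[of _ P]) auto
  next
    assume weight: "dc_weight k L = dc_weight k M + dc_weight k N"
    \<comment> \<open>All supports lie in \<open>{1..m}\<close>, so the bound by \<open>n\<close>
      removes nothing and the counted set does not change with \<open>n\<close>.\<close>
    have "coset_factors_at k M N g n = coset_factors k M N g" if "m \<le> n" for n
      using block_support_coset_factors[OF k assms(2,3,4) weight g] that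
      by (fastforce simp: coset_factors_at_def)
    then show "\<exists>C. \<forall>n\<ge>1.
        dc_part k M n \<noteq> {} \<and> dc_part k N n \<noteq> {} \<and> dc_part k L n \<noteq> {} \<longrightarrow>
          struct_coeff k M N L n = C"
      using coeff by (intro exI[of _ "of_nat (card (coset_factors k M N g))"]) auto
  qed
qed

end
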